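(* Let $n\ge1$ and let $w\in S_n$ be such that the Grothendieck polynomial $\mathfrak{G}_w(x)=\sum_{\alpha}C_{w\alpha}x^\alpha$ is zero-one (all its coefficients are $0$, $1$ or $-1$). Then the following hold. (1) If $\alpha\in\mathrm{supp}(\mathfrak{G}_w(x))$ and $|\alpha|<\deg(\mathfrak{G}_w(x))$, then there exists $\beta\in\mathrm{supp}(\mathfrak{G}_w(x))$ with $\alpha<\beta$. (2) If $\alpha\in\mathrm{supp}(\mathfrak{G}_w(x))$ and $|\alpha|<\deg(\mathfrak{G}_w(x))$, then there exists $\beta\in\mathrm{supp}(\mathfrak{G}_w(x))$ with $\alpha<\beta$ and $|\beta|=|\alpha|+1$. (3) For any $\beta\in\mathrm{supp}(\mathfrak{G}_w^{top}(x))$, i.e., such that $x^\beta$ is a monomial of the highest degree occurring in $\mathfrak{G}_w(x)$, we have $$\sum_{\alpha\le\beta}C_{w\alpha}=1.$$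
   Context: $S_n$ is the symmetric group on $[n]=\{1,\ldots,n\}$. For a polynomial $f$ in $x_1,\ldots,x_n$, $s_if$ interchanges $x_i$ and $x_{i+1}$ in $f$, and $$\pi_i f=\frac{(1-x_{i+1})f-(1-x_i)s_if}{x_i-x_{i+1}}.$$ Grothendieck polynomials: for $w_0=n(n-1)\cdots21$, $\mathfrak{G}_{w_0}(x)=\prod_{i+j\le n}x_i$ (product over pairs of positive integers with $i+j\le n$); if $w(i)<w(i+1)$ then $\mathfrak{G}_w(x)=\pi_i\mathfrak{G}_{ws_i}(x)$, where $ws_i$ is obtained from $w$ by interchanging $w(i)$ and $w(i+1)$. The support of $f=\sum_\alpha c_\alpha x^\alpha$ is $\mathrm{supp}(f)=\{\alpha:c_\alpha\neq0\}$. For a vector $\alpha=(\alpha_1,\ldots,\alpha_n)$, $|\alpha|=\alpha_1+\cdots+\alpha_n$. The order is componentwise: $\alpha\le\beta$ iff $\alpha_i\le\beta_i$ for all $i$, and $\alpha<\beta$ means $\alpha\le\beta$ and $\alpha\ne\beta$. $\deg(\mathfrak{G}_w(x))$ is the (total) degree of $\mathfrak{G}_w(x)$, and $\mathfrak{G}_w^{top}(x)$ is its homogeneous component of highest degree. *)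

theory Defs
  imports "HOL-Library.Poly_Mapping" "HOL-Combinatorics.Permutations"
begin

section \<open>Polynomials, supports and degrees\<close>

text \<open>
  A polynomial is a finitely supported map from exponent vectors to integer coefficients, with the
  convolution product of \<^theory>\<open>HOL-Library.Poly_Mapping\<close>. An exponent vector is itself a finitely
  supported map from the indices of the variables to the natural numbers; the coefficient of
  \<open>x\<^sup>\<alpha>\<close> in \<open>f\<close> is \<open>lookup f \<alpha>\<close> and \<open>supp(f)\<close> is \<open>keys f\<close>.
\<close>

type_synonym expvec = "nat \<Rightarrow>\<^sub>0 nat"
type_synonym mpoly = "expvec \<Rightarrow>\<^sub>0 int"

abbreviation coeff :: "mpoly \<Rightarrow> expvec \<Rightarrow> int" where
  "coeff \<equiv> Poly_Mapping.lookup"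

abbreviation supp :: "mpoly \<Rightarrow> expvec set" where
  "supp \<equiv> Poly_Mapping.keys"

definition var :: "nat \<Rightarrow> mpoly" where
  "var i = Poly_Mapping.single (Poly_Mapping.single i 1) 1"

definition weight :: "expvec \<Rightarrow> nat" where
  "weight \<alpha> = (\<Sum>i\<in>Poly_Mapping.keys \<alpha>. Poly_Mapping.lookup \<alpha> i)"

text \<open>
  The componentwise order. The library's \<open>\<le>\<close> on finitely supported maps is a lexicographic linear
  order and must not be used here.
\<close>

definition exp_le :: "expvec \<Rightarrow> expvec \<Rightarrow> bool" (infix \<open>\<preceq>\<close> 50) where
  "\<alpha> \<preceq> \<beta> \<longleftrightarrow> (\<forall>i. Poly_Mapping.lookup \<alpha> i \<le> Poly_Mapping.lookup \<beta> i)"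

definition exp_less :: "expvec \<Rightarrow> expvec \<Rightarrow> bool" (infix \<open>\<prec>\<close> 50) where
  "\<alpha> \<prec> \<beta> \<longleftrightarrow> \<alpha> \<preceq> \<beta> \<and> \<alpha> \<noteq> \<beta>"

text \<open>The zero polynomial gets degree \<open>0\<close>.\<close>

definition total_degree :: "mpoly \<Rightarrow> nat" where
  "total_degree f = Max (insert 0 (weight ` supp f))"

definition homogeneous_component :: "nat \<Rightarrow> mpoly \<Rightarrow> mpoly" where
  "homogeneous_component d f =
     (\<Sum>\<alpha> | \<alpha> \<in> supp f \<and> weight \<alpha> = d. Poly_Mapping.single \<alpha> (coeff f \<alpha>))"

definition top_component :: "mpoly \<Rightarrow> mpoly" where
  "top_component f = homogeneous_component (total_degree f) f"

definition zero_one :: "mpoly \<Rightarrow> bool" where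
  "zero_one f \<longleftrightarrow> (\<forall>\<alpha>. coeff f \<alpha> \<in> {0, 1, -1})"


section \<open>Grothendieck polynomials\<close>

text \<open>
  Both \<open>map_key\<close> operations precompose with an involution: the coefficient of \<open>x\<^sup>\<alpha>\<close> in
  \<open>swap_vars i f\<close> is the coefficient in \<open>f\<close> of \<open>x\<^sup>\<alpha>\<close> with \<open>x\<^sub>i\<close> and \<open>x\<^sub>i\<^sub>+\<^sub>1\<close> interchanged.
\<close>

definition swap_vars :: "nat \<Rightarrow> mpoly \<Rightarrow> mpoly" where
  "swap_vars i f =
     Poly_Mapping.map_key (Poly_Mapping.map_key (transpose i (Suc i))) f"

text \<open>
  The divided difference is a polynomial; it is specified here as the exact quotient, whose existence
  and uniqueness are proved in \<open>demazure_unique_exists\<close>.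
\<close>

definition demazure :: "nat \<Rightarrow> mpoly \<Rightarrow> mpoly" (\<open>\<pi>\<close>) where
  "\<pi> i f = (THE g. (var i - var (Suc i)) * g
                     = (1 - var (Suc i)) * f - (1 - var i) * swap_vars i f)"

definition longest_perm :: "nat \<Rightarrow> nat \<Rightarrow> nat" where
  "longest_perm n i = (if i \<in> {1..n} then n + 1 - i else i)"

text \<open>
  Permutations of \<open>[n]\<close> are functions that permute \<open>{1..n}\<close> and are the identity elsewhere.
  \<open>is_grothendieck n w f\<close> says that \<open>f\<close> is obtained for \<open>w\<close> by some run of the recursion, which
  starts at the longest permutation and may use any ascent in each step. That the outcome exists and
  does not depend on the run is proved in \<open>grothendieck_unique_exists\<close>, and the defining equations of
  the Grothendieck polynomials are \<open>grothendieck_longest\<close> and \<open>grothendieck_ascent\<close>.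
\<close>

inductive is_grothendieck :: "nat \<Rightarrow> (nat \<Rightarrow> nat) \<Rightarrow> mpoly \<Rightarrow> bool" for n where
  longest: "is_grothendieck n (longest_perm n) (\<Prod>(i, j) | 1 \<le> i \<and> 1 \<le> j \<and> i + j \<le> n. var i)"
| ascent: "is_grothendieck n (w \<circ> transpose i (Suc i)) g \<Longrightarrow> 1 \<le> i \<Longrightarrow> i < n \<Longrightarrow> w i < w (Suc i)
    \<Longrightarrow> is_grothendieck n w (\<pi> i g)"

definition grothendieck :: "nat \<Rightarrow> (nat \<Rightarrow> nat) \<Rightarrow> mpoly" where
  "grothendieck n w = (THE f. is_grothendieck n w f)"


section \<open>The definitions make sense\<close>

lemma finite_exp_le: "finite {\<alpha>. \<alpha> \<preceq> \<beta>}"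
proof -
  let ?S = "Poly_Mapping.keys \<beta>"
  let ?B = "{f. \<forall>i. (i \<in> ?S \<longrightarrow> f i \<in> {..weight \<beta>}) \<and> (i \<notin> ?S \<longrightarrow> f i = (0::nat))}"
  have "finite ?B"
    by (rule finite_set_of_finite_funs) auto
  moreover have "Poly_Mapping.lookup ` {\<alpha>. \<alpha> \<preceq> \<beta>} \<subseteq> ?B"
  proof safe
    fix \<alpha> i assume le: "\<alpha> \<preceq> \<beta>"
    then have "Poly_Mapping.lookup \<alpha> i \<le> Poly_Mapping.lookup \<beta> i"
      by (simp add: exp_le_def)
    moreover have "i \<in> ?S \<Longrightarrow> Poly_Mapping.lookup \<beta> i \<le> weight \<beta>"
      unfolding weight_def by (rule member_le_sum) auto
    ultimately show "i \<in> ?S \<Longrightarrow> Poly_Mapping.lookup \<alpha> i \<le> weight \<beta>" by simp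
    show "i \<notin> ?S \<Longrightarrow> Poly_Mapping.lookup \<alpha> i = 0"
      using le by (metis exp_le_def in_keys_iff le_zero_eq)
  qed
  ultimately have "finite (Poly_Mapping.lookup ` {\<alpha>. \<alpha> \<preceq> \<beta>})"
    by (rule finite_subset[rotated])
  then show ?thesis
    by (rule finite_imageD) (auto intro!: inj_onI poly_mapping_eqI)
qed

lemma coeff_homogeneous_component:
  "coeff (homogeneous_component d f) \<alpha> = (if weight \<alpha> = d then coeff f \<alpha> else 0)"
proof -
  have "coeff (homogeneous_component d f) \<alpha> =
      (\<Sum>\<gamma> | \<gamma> \<in> supp f \<and> weight \<gamma> = d. if \<gamma> = \<alpha> then coeff f \<gamma> else 0)"
    unfolding homogeneous_component_def lookup_sum
    by (rule sum.cong) (auto simp: lookup_single when_def)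
  also have "\<dots> = (if weight \<alpha> = d then coeff f \<alpha> else 0)"
    by (subst sum.delta) (auto simp: in_keys_iff)
  finally show ?thesis .
qed

lemma poly_mapping_add_induct [case_names single add]:
  fixes p :: "'a \<Rightarrow>\<^sub>0 'b::comm_monoid_add"
  assumes "\<And>k c. P (Poly_Mapping.single k c)" "\<And>p q. P p \<Longrightarrow> P q \<Longrightarrow> P (p + q)"
  shows "P p"
proof -
  have expand: "p = (\<Sum>k\<in>Poly_Mapping.keys p. Poly_Mapping.single k (Poly_Mapping.lookup p k))"
    by (rule poly_mapping_eqI)
      (simp add: lookup_sum lookup_single when_def sum.delta in_keys_iff)
  have zero: "P 0" using assms(1)[of undefined 0] by simp
  have "P (\<Sum>k\<in>A. Poly_Mapping.single k (Poly_Mapping.lookup p k))" if "finite A" for A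
    using that by (induction A) (auto intro: assms zero)
  then show ?thesis using expand by (metis finite_keys)
qed

lemma inj_map_key_transpose:
  "inj (Poly_Mapping.map_key (transpose i (Suc i)) :: expvec \<Rightarrow> expvec)"
proof (rule injI)
  fix \<alpha> \<beta> :: expvec
  assume "Poly_Mapping.map_key (transpose i (Suc i)) \<alpha> = Poly_Mapping.map_key (transpose i (Suc i)) \<beta>"
  then have "Poly_Mapping.map_key (transpose i (Suc i)) (Poly_Mapping.map_key (transpose i (Suc i)) \<alpha>)
    = Poly_Mapping.map_key (transpose i (Suc i)) (Poly_Mapping.map_key (transpose i (Suc i)) \<beta>)" by simp
  then show "\<alpha> = \<beta>" by (simp add: map_key_compose map_key_id id_def)
qed

lemma map_key_transpose_twice:
  "Poly_Mapping.map_key (transpose i (Suc i)) (Poly_Mapping.map_key (transpose i (Suc i)) \<alpha>) = \<alpha>"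
  by (simp add: map_key_compose map_key_id id_def)

lemma map_key_transpose_single:
  "Poly_Mapping.map_key (transpose i (Suc i)) (Poly_Mapping.single j c)
     = Poly_Mapping.single (transpose i (Suc i) j) c"
  using map_key_single[of "transpose i (Suc i)" "transpose i (Suc i) j" c] by simp

lemma swap_vars_add: "swap_vars i (f + g) = swap_vars i f + swap_vars i g"
  by (simp add: swap_vars_def map_key_plus inj_map_key_transpose)

lemma swap_vars_twice [simp]: "swap_vars i (swap_vars i f) = f"
  by (simp add: swap_vars_def map_key_compose inj_map_key_transpose map_key_transpose_twice
      map_key_id o_def)

lemma swap_vars_single:
  "swap_vars i (Poly_Mapping.single \<alpha> c)
     = Poly_Mapping.single (Poly_Mapping.map_key (transpose i (Suc i)) \<alpha>) c"
  using map_key_single[OF inj_map_key_transpose, of i "Poly_Mapping.map_key (transpose i (Suc i)) \<alpha>" c]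
  by (simp add: swap_vars_def map_key_transpose_twice)

lemma swap_vars_mult: "swap_vars i (f * g) = swap_vars i f * swap_vars i g"
proof (induction f rule: poly_mapping_add_induct)
  case (single \<alpha> c)
  show ?case
  proof (induction g rule: poly_mapping_add_induct)
    case (single \<beta> d)
    then show ?case by (simp add: swap_vars_single mult_single map_key_plus)
  next
    case (add p q)
    then show ?case by (simp add: swap_vars_add distrib_left)
  qed
next
  case (add p q)
  then show ?case by (simp add: swap_vars_add distrib_right)
qed

lemma swap_vars_1 [simp]: "swap_vars i 1 = 1"
  using swap_vars_single[of i 0 1] by simp

lemma swap_vars_minus: "swap_vars i (f - g) = swap_vars i f - swap_vars i g"
  using swap_vars_add[of i "f - g" g] by simp

lemma swap_vars_var: "swap_vars i (var j) = var (transpose i (Suc i) j)"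
  by (simp add: var_def swap_vars_single map_key_transpose_single)

lemma var_power: "var i ^ m = Poly_Mapping.single (Poly_Mapping.single i m) 1"
  by (induction m) (simp_all add: var_def mult_single single_add[symmetric])

lemma mpoly_induct [case_names const var add mult]:
  fixes f :: mpoly
  assumes const: "\<And>c. P (Poly_Mapping.single 0 c)" and var: "\<And>i. P (var i)"
    and add: "\<And>f g. P f \<Longrightarrow> P g \<Longrightarrow> P (f + g)" and mult: "\<And>f g. P f \<Longrightarrow> P g \<Longrightarrow> P (f * g)"
  shows "P f"
proof (induction f rule: poly_mapping_add_induct)
  case (single \<alpha> c)
  have one: "P 1" using const[of 1] by simp
  have power: "P (var i ^ m)" for i m
    by (induction m) (auto intro: one var mult)
  have "P (Poly_Mapping.single \<alpha> 1)"
  proof (induction \<alpha> rule: poly_mapping_add_induct)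
    case (single k m)
    then show ?case using power[of k m] by (simp add: var_power)
  next
    case (add \<alpha> \<beta>)
    then show ?case using mult[OF add] by (simp add: mult_single)
  qed
  from mult[OF const[of c] this] show ?case by (simp add: mult_single)
next
  case (add p q)
  then show ?case by (rule assms(3))
qed

lemma var_diff_nonzero: "i \<noteq> j \<Longrightarrow> var i - var j \<noteq> 0"
proof
  assume ij: "i \<noteq> j" and "var i - var j = 0"
  then have "Poly_Mapping.single i (1::nat) = Poly_Mapping.single j 1"
    by (metis eq_iff_diff_eq_0 keys_single singleton_inject var_def zero_neq_one)
  then show False using ij by (metis keys_single singleton_inject zero_neq_one)
qed

lemma var_diff_dvd_swap: "var i - var (Suc i) dvd f - swap_vars i f"
proof (induction f rule: mpoly_induct)
  case (const c)
  then show ?case by (simp add: swap_vars_single)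
next
  case (var j)
  consider "j = i" | "j = Suc i" | "j \<noteq> i" "j \<noteq> Suc i" by blast
  then show ?case
  proof cases
    case 2
    have "var (Suc i) - var i = (var i - var (Suc i)) * (- 1)" by simp
    then show ?thesis using 2 by (simp only: swap_vars_var transpose_apply_second dvd_triv_left)
  qed (simp_all add: swap_vars_var)
next
  case (add f g)
  then have "var i - var (Suc i) dvd (f - swap_vars i f) + (g - swap_vars i g)" by (rule dvd_add)
  then show ?case by (simp add: swap_vars_add algebra_simps)
next
  case (mult f g)
  then have "var i - var (Suc i) dvd (f - swap_vars i f) * g + swap_vars i f * (g - swap_vars i g)"
    by simp
  then show ?case by (simp add: swap_vars_mult algebra_simps)
qed

lemma demazure_unique_exists:
  "\<exists>!g. (var i - var (Suc i)) * g = (1 - var (Suc i)) * f - (1 - var i) * swap_vars i f"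
proof -
  obtain h where "f - swap_vars i f = (var i - var (Suc i)) * h"
    using var_diff_dvd_swap by (rule dvdE)
  then have "(var i - var (Suc i)) * ((1 - var (Suc i)) * h + swap_vars i f)
      = (1 - var (Suc i)) * f - (1 - var i) * swap_vars i f"
    by algebra
  moreover have "g = h" if "(var i - var (Suc i)) * g = (var i - var (Suc i)) * h" for g h
    using that var_diff_nonzero[of i "Suc i"] by simp
  ultimately show ?thesis by metis
qed

lemma demazure_eq:
  "(var i - var (Suc i)) * \<pi> i f = (1 - var (Suc i)) * f - (1 - var i) * swap_vars i f"
  unfolding demazure_def using theI'[OF demazure_unique_exists] .

lemma swap_vars_demazure: "swap_vars i (\<pi> i f) = \<pi> i f"
proof -
  have "(var (Suc i) - var i) * swap_vars i (\<pi> i f)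
      = (1 - var i) * swap_vars i f - (1 - var (Suc i)) * f"
    using arg_cong[OF demazure_eq[of i f], of "swap_vars i"]
    by (simp add: swap_vars_mult swap_vars_minus swap_vars_var)
  then have "(var i - var (Suc i)) * swap_vars i (\<pi> i f) = (var i - var (Suc i)) * \<pi> i f"
    using demazure_eq[of i f] by algebra
  then show ?thesis using var_diff_nonzero[of i "Suc i"] by simp
qed

lemma swap_vars_const [simp]: "swap_vars i (Poly_Mapping.single 0 c) = Poly_Mapping.single 0 c"
  by (simp add: swap_vars_single)

lemma swap_vars_commute:
  assumes "Suc i < j"
  shows "swap_vars i (swap_vars j f) = swap_vars j (swap_vars i f)"
proof (induction f rule: mpoly_induct)
  case (var k)
  then show ?case using assms by (simp add: swap_vars_var transpose_def)
qed (simp_all add: swap_vars_add swap_vars_mult)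

lemma swap_vars_braid:
  "swap_vars i (swap_vars (Suc i) (swap_vars i f))
     = swap_vars (Suc i) (swap_vars i (swap_vars (Suc i) f))"
proof (induction f rule: mpoly_induct)
  case (var k)
  then show ?case by (simp add: swap_vars_var transpose_def)
qed (simp_all add: swap_vars_add swap_vars_mult)

lemma demazure_commute_expand:
  assumes "Suc i < j \<or> Suc j < i"
  shows "(var i - var (Suc i)) * (var j - var (Suc j)) * \<pi> i (\<pi> j f)
    = (1 - var (Suc i)) * ((1 - var (Suc j)) * f - (1 - var j) * swap_vars j f)
      - (1 - var i) * ((1 - var (Suc j)) * swap_vars i f - (1 - var j) * swap_vars i (swap_vars j f))"
proof -
  let ?g = "\<pi> j f"
  have g: "(var j - var (Suc j)) * ?g = (1 - var (Suc j)) * f - (1 - var j) * swap_vars j f"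
    by (rule demazure_eq)
  have sg: "(var j - var (Suc j)) * swap_vars i ?g
      = (1 - var (Suc j)) * swap_vars i f - (1 - var j) * swap_vars i (swap_vars j f)"
  proof -
    have "swap_vars i (var j) = var j" "swap_vars i (var (Suc j)) = var (Suc j)"
      using assms by (auto simp: swap_vars_var transpose_def)
    then show ?thesis
      using arg_cong[OF g, of "swap_vars i"]
      by (simp only: swap_vars_mult swap_vars_minus swap_vars_1)
  qed
  have "(var i - var (Suc i)) * (var j - var (Suc j)) * \<pi> i ?g
      = (var j - var (Suc j)) * ((1 - var (Suc i)) * ?g - (1 - var i) * swap_vars i ?g)"
    unfolding demazure_eq[of i ?g, symmetric] by (simp only: mult_ac)
  also have "\<dots> = (1 - var (Suc i)) * ((var j - var (Suc j)) * ?g)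
      - (1 - var i) * ((var j - var (Suc j)) * swap_vars i ?g)" by algebra
  finally show ?thesis unfolding g sg .
qed

lemma demazure_commute:
  assumes "Suc i < j"
  shows "\<pi> i (\<pi> j f) = \<pi> j (\<pi> i f)"
proof -
  have "(var i - var (Suc i)) * (var j - var (Suc j)) * \<pi> i (\<pi> j f)
      = (var j - var (Suc j)) * (var i - var (Suc i)) * \<pi> j (\<pi> i f)"
    using assms by (simp only: demazure_commute_expand swap_vars_commute disj_commute simp_thms)
      (simp add: swap_vars_commute[OF assms, of f] algebra_simps)
  then have "(var i - var (Suc i)) * (var j - var (Suc j)) * \<pi> i (\<pi> j f)
      = (var i - var (Suc i)) * (var j - var (Suc j)) * \<pi> j (\<pi> i f)"
    by (simp add: mult.commute)
  then show ?thesis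
    using var_diff_nonzero[of i "Suc i"] var_diff_nonzero[of j "Suc j"] by simp
qed

lemma demazure_braid:
  "\<pi> i (\<pi> (Suc i) (\<pi> i f)) = \<pi> (Suc i) (\<pi> i (\<pi> (Suc i) f))"
proof -
  define a b c where abc: "a = var i" "b = var (Suc i)" "c = var (Suc (Suc i))"
  let ?s = "swap_vars i" and ?t = "swap_vars (Suc i)"
  note sv = swap_vars_mult swap_vars_minus abc[symmetric]
  have swaps: "?s a = b" "?s b = a" "?s c = c" "?t a = a" "?t b = c" "?t c = b"
    by (simp_all add: abc swap_vars_var transpose_def)
  have eqs: "(a - b) * \<pi> i h = (1 - b) * h - (1 - a) * ?s h"
    and eqt: "(b - c) * \<pi> (Suc i) h = (1 - c) * h - (1 - b) * ?t h" for h
    by (simp_all add: abc demazure_eq)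
  note hom = swap_vars_mult swap_vars_minus swap_vars_1 swaps
  have D: "(a - b) * (a - c) * (b - c) \<noteq> 0"
    using var_diff_nonzero[of i "Suc i"] var_diff_nonzero[of i "Suc (Suc i)"]
      var_diff_nonzero[of "Suc i" "Suc (Suc i)"] by (simp add: abc)
  let ?E = "(1 - c)^2 * ((1 - b) * f - (1 - a) * ?s f)
      - (1 - b)^2 * ((1 - c) * ?t f - (1 - a) * ?t (?s f))
      + (1 - a)^2 * ((1 - c) * ?s (?t f) - (1 - b) * ?s (?t (?s f)))"
  have 1: "(a - b) * (a - c) * (b - c) * \<pi> i (\<pi> (Suc i) (\<pi> i f)) = ?E"
  proof -
    define g h k where ghk: "g = \<pi> i f" "h = \<pi> (Suc i) g" "k = \<pi> i h"
    have sg: "?s g = g" by (simp add: ghk swap_vars_demazure)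
    have k: "(a - b) * k = (1 - b) * h - (1 - a) * ?s h" by (simp add: ghk eqs)
    have h: "(b - c) * h = (1 - c) * g - (1 - b) * ?t g" by (simp add: ghk eqt)
    have g: "(a - b) * g = (1 - b) * f - (1 - a) * ?s f" by (simp add: ghk eqs)
    have sh: "(a - c) * ?s h = (1 - c) * g - (1 - a) * ?s (?t g)"
      using arg_cong[OF h, of ?s] by (simp only: hom sg)
    have tg: "(a - c) * ?t g = (1 - c) * ?t f - (1 - a) * ?t (?s f)"
      using arg_cong[OF g, of ?t] by (simp only: hom)
    have stg: "(b - c) * ?s (?t g) = (1 - c) * ?s (?t f) - (1 - b) * ?s (?t (?s f))"
      using arg_cong[OF tg, of ?s] by (simp only: hom)
    have "(a - b) * (a - c) * (b - c) * k = (a - c) * (b - c) * ((a - b) * k)"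
      by (simp only: mult_ac)
    also have "\<dots> = (a - c) * (1 - b) * ((b - c) * h) - (b - c) * (1 - a) * ((a - c) * ?s h)"
      unfolding k by (simp only: algebra_simps)
    also have "\<dots> = (1 - c)^2 * ((a - b) * g) - (1 - b)^2 * ((a - c) * ?t g)
        + (1 - a)^2 * ((b - c) * ?s (?t g))"
      unfolding h sh by (simp add: algebra_simps power2_eq_square)
    also have "\<dots> = ?E" unfolding g tg stg ..
    finally show ?thesis by (simp only: ghk)
  qed
  have 2: "(a - b) * (a - c) * (b - c) * \<pi> (Suc i) (\<pi> i (\<pi> (Suc i) f)) = ?E"
  proof -
    define g h k where ghk: "g = \<pi> (Suc i) f" "h = \<pi> i g" "k = \<pi> (Suc i) h"
    have tg: "?t g = g" by (simp add: ghk swap_vars_demazure)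
    have k: "(b - c) * k = (1 - c) * h - (1 - b) * ?t h" by (simp add: ghk eqt)
    have h: "(a - b) * h = (1 - b) * g - (1 - a) * ?s g" by (simp add: ghk eqs)
    have g: "(b - c) * g = (1 - c) * f - (1 - b) * ?t f" by (simp add: ghk eqt)
    have th: "(a - c) * ?t h = (1 - c) * g - (1 - a) * ?t (?s g)"
      using arg_cong[OF h, of ?t] by (simp only: hom tg)
    have sg: "(a - c) * ?s g = (1 - c) * ?s f - (1 - a) * ?s (?t f)"
      using arg_cong[OF g, of ?s] by (simp only: hom)
    have tsg: "(a - b) * ?t (?s g) = (1 - b) * ?t (?s f) - (1 - a) * ?s (?t (?s f))"
      using arg_cong[OF sg, of ?t] by (simp only: hom swap_vars_braid)
    have "(a - b) * (a - c) * (b - c) * k = (a - b) * (a - c) * ((b - c) * k)"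
      by (simp only: mult_ac)
    also have "\<dots> = (a - c) * (1 - c) * ((a - b) * h) - (a - b) * (1 - b) * ((a - c) * ?t h)"
      unfolding k by (simp only: algebra_simps)
    also have "\<dots> = (1 - b) * (1 - c) * ((b - c) * g) - (1 - a) * (1 - c) * ((a - c) * ?s g)
        + (1 - a) * (1 - b) * ((a - b) * ?t (?s g))"
      unfolding h th by (simp add: algebra_simps)
    also have "\<dots> = ?E" unfolding g sg tsg by (simp add: algebra_simps power2_eq_square)
    finally show ?thesis by (simp only: ghk)
  qed
  show ?thesis using 1 2 D by (metis mult_left_cancel)
qed

lemma longest_perm_descents: "1 \<le> i \<Longrightarrow> i < n \<Longrightarrow> longest_perm n (Suc i) < longest_perm n i"
  by (simp add: longest_perm_def)

lemma longest_perm_permutes: "longest_perm n permutes {1..n}"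
proof (rule bij_imp_permutes)
  show "bij_betw (longest_perm n) {1..n} {1..n}"
    by (rule bij_betwI[where g = "longest_perm n"]) (auto simp: longest_perm_def)
qed (auto simp: longest_perm_def)

lemma no_ascent_imp_longest:
  assumes w: "w permutes {1..n}" and desc: "\<And>i. 1 \<le> i \<Longrightarrow> i < n \<Longrightarrow> \<not> w i < w (Suc i)"
  shows "w = longest_perm n"
proof
  fix i
  have step: "w (Suc i) < w i" if "1 \<le> i" "i < n" for i
    using desc[OF that] permutes_inj[OF w]
    by (metis antisym_conv3 injD n_not_Suc_n)
  have rng: "1 \<le> w i \<and> w i \<le> n" if "i \<in> {1..n}" for i
    using permutes_in_image[OF w, of i] that by simp
  have upper: "w (Suc k) + k \<le> n" if "k < n" for k
    using that
  proof (induction k)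
    case 0
    then show ?case using rng[of 1] by simp
  next
    case (Suc k)
    then show ?case using step[of "Suc k"] by simp
  qed
  have lower: "k < w (n - k)" if "k < n" for k
    using that
  proof (induction k)
    case 0
    then show ?case using rng[of n] by simp
  next
    case (Suc k)
    then have "Suc (n - Suc k) = n - k" by simp
    then show ?case using step[of "n - Suc k"] Suc by (simp add: Suc_le_eq)
  qed
  show "w i = longest_perm n i"
  proof (cases "i \<in> {1..n}")
    case True
    then have "w i + (i - 1) \<le> n" "n - i < w (n - (n - i))" "1 \<le> i" "i \<le> n" "n - (n - i) = i"
      using upper[of "i - 1"] lower[of "n - i"] by auto
    then have "w i = n + 1 - i" by simp
    then show ?thesis using True by (simp add: longest_perm_def)
  next
    case False
    then show ?thesis using permutes_not_in[OF w False] by (simp only: longest_perm_def if_False)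
  qed
qed

definition noninversions :: "nat \<Rightarrow> (nat \<Rightarrow> nat) \<Rightarrow> (nat \<times> nat) set" where
  "noninversions n w = {(p, q). 1 \<le> p \<and> p < q \<and> q \<le> n \<and> w p < w q}"

lemma card_noninversions_less:
  assumes "1 \<le> i" "i < n" "w i < w (Suc i)"
  shows "card (noninversions n (w \<circ> transpose i (Suc i))) < card (noninversions n w)"
proof -
  let ?t = "transpose i (Suc i)"
  have fin: "finite (noninversions n w)"
    by (rule finite_subset[of _ "{1..n} \<times> {1..n}"]) (auto simp: noninversions_def)
  have "(\<lambda>(p, q). (?t p, ?t q)) ` noninversions n (w \<circ> ?t) \<subseteq> noninversions n w - {(i, Suc i)}"
  proof safe
    fix p q assume pq: "(p, q) \<in> noninversions n (w \<circ> ?t)"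
    then have "\<not> (p = i \<and> q = Suc i)"
      using assms by (auto simp: noninversions_def)
    moreover have "1 \<le> p" "p < q" "q \<le> n" "w (?t p) < w (?t q)"
      using pq by (auto simp: noninversions_def)
    ultimately show "(?t p, ?t q) \<in> noninversions n w"
      using assms by (auto simp: noninversions_def transpose_def)
    assume "?t p = i" "?t q = Suc i"
    then show False using \<open>p < q\<close> by (auto simp: transpose_def split: if_splits)
  qed
  moreover have "inj_on (\<lambda>(p, q). (?t p, ?t q)) (noninversions n (w \<circ> ?t))"
    by (auto intro!: inj_onI dest: transpose_eq_imp_eq)
  ultimately have "card (noninversions n (w \<circ> ?t)) \<le> card (noninversions n w - {(i, Suc i)})"
    using fin by (metis card_image card_mono finite_Diff)
  also have "\<dots> < card (noninversions n w)"
    by (rule card_Diff1_less[OF fin]) (use assms in \<open>auto simp: noninversions_def\<close>)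
  finally show ?thesis .
qed

lemma permutes_transpose_Suc:
  "w permutes {1..n} \<Longrightarrow> 1 \<le> i \<Longrightarrow> i < n \<Longrightarrow> w \<circ> transpose i (Suc i) permutes {1..n}"
  by (rule permutes_compose[OF permutes_swap_id]) auto

lemma is_grothendieck_exists:
  "w permutes {1..n} \<Longrightarrow> \<exists>f. is_grothendieck n w f"
proof (induction "card (noninversions n w)" arbitrary: w rule: less_induct)
  case less
  show ?case
  proof (cases "\<exists>i. 1 \<le> i \<and> i < n \<and> w i < w (Suc i)")
    case True
    then obtain i where i: "1 \<le> i" "i < n" "w i < w (Suc i)" by blast
    obtain g where "is_grothendieck n (w \<circ> transpose i (Suc i)) g"
      using less.hyps[OF card_noninversions_less permutes_transpose_Suc] i less.prems by blast
    then show ?thesis using is_grothendieck.ascent i by blast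
  next
    case False
    then have "w = longest_perm n" using no_ascent_imp_longest[OF less.prems] by blast
    then show ?thesis using is_grothendieck.longest by blast
  qed
qed

lemma is_grothendieck_unique:
  "w permutes {1..n} \<Longrightarrow> is_grothendieck n w f \<Longrightarrow> is_grothendieck n w f' \<Longrightarrow> f = f'"
proof (induction "card (noninversions n w)" arbitrary: w f f' rule: less_induct)
  case less
  let ?t = "\<lambda>i. transpose i (Suc i)"
  let ?asc = "\<lambda>i. 1 \<le> i \<and> i < n \<and> w i < w (Suc i)"
  note perm = less.prems(1)
  have IH: "f1 = f2"
    if "?asc i" "is_grothendieck n (w \<circ> ?t i) f1" "is_grothendieck n (w \<circ> ?t i) f2" for i f1 f2
    using less.hyps[OF card_noninversions_less permutes_transpose_Suc] that perm by blast
  have sub: "\<exists>g. is_grothendieck n v g" if "v permutes {1..n}" for v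
    using is_grothendieck_exists that .
  have main: "\<pi> i g = \<pi> j g'"
    if i: "?asc i" and j: "?asc j" and g: "is_grothendieck n (w \<circ> ?t i) g"
      and g': "is_grothendieck n (w \<circ> ?t j) g'" and ij: "i \<le> j" for i j g g'
  proof -
    consider "i = j" | "j = Suc i" | "Suc i < j" using ij by linarith
    then show ?thesis
    proof cases
      case 1
      then show ?thesis using IH i g g' by blast
    next
      case 2
      have Suc_n: "Suc i < n" and lt: "w i < w (Suc i)" "w (Suc i) < w (Suc (Suc i))"
        using i j 2 by auto
      let ?v = "w \<circ> ?t i \<circ> ?t (Suc i) \<circ> ?t i"
      have v: "w \<circ> ?t (Suc i) \<circ> ?t i \<circ> ?t (Suc i) = ?v"
        by (auto simp: fun_eq_iff transpose_def)
      have "?v permutes {1..n}"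
        using perm i Suc_n by (intro permutes_transpose_Suc) auto
      then obtain u where u: "is_grothendieck n ?v u" using sub by blast
      have "is_grothendieck n (w \<circ> ?t i \<circ> ?t (Suc i)) (\<pi> i u)"
        by (rule is_grothendieck.ascent[OF u]) (use i Suc_n lt in \<open>auto simp: transpose_def\<close>)
      then have "is_grothendieck n (w \<circ> ?t i) (\<pi> (Suc i) (\<pi> i u))"
        by (rule is_grothendieck.ascent) (use i Suc_n lt in \<open>auto simp: transpose_def\<close>)
      then have 1: "g = \<pi> (Suc i) (\<pi> i u)" using IH i g by blast
      have "is_grothendieck n (w \<circ> ?t (Suc i) \<circ> ?t i) (\<pi> (Suc i) u)"
        by (rule is_grothendieck.ascent[OF u[folded v]])
          (use i Suc_n lt in \<open>auto simp: transpose_def\<close>)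
      then have "is_grothendieck n (w \<circ> ?t (Suc i)) (\<pi> i (\<pi> (Suc i) u))"
        by (rule is_grothendieck.ascent) (use i Suc_n lt in \<open>auto simp: transpose_def\<close>)
      then have "g' = \<pi> i (\<pi> (Suc i) u)" using IH j g' 2 by blast
      then show ?thesis using 1 2 by (simp add: demazure_braid)
    next
      case 3
      let ?v = "w \<circ> ?t i \<circ> ?t j"
      have v: "w \<circ> ?t j \<circ> ?t i = ?v"
        using 3 by (auto simp: fun_eq_iff transpose_def)
      have "?v permutes {1..n}"
        using perm i j by (intro permutes_transpose_Suc) auto
      then obtain u where u: "is_grothendieck n ?v u" using sub by blast
      have "is_grothendieck n (w \<circ> ?t i) (\<pi> j u)"
        by (rule is_grothendieck.ascent[OF u]) (use i j 3 in \<open>auto simp: transpose_def\<close>)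
      then have 1: "g = \<pi> j u" using IH i g by blast
      have "is_grothendieck n (w \<circ> ?t j) (\<pi> i u)"
        by (rule is_grothendieck.ascent[OF u[folded v]])
          (use i j 3 in \<open>auto simp: transpose_def\<close>)
      then have "g' = \<pi> i u" using IH j g' by blast
      then show ?thesis using 1 demazure_commute[OF 3, of u] by simp
    qed
  qed
  have no_asc: "\<not> ?asc i" if "w = longest_perm n" for i
    using longest_perm_descents[of i n] that by auto
  show ?case
    using less.prems(2)
  proof cases
    case longest
    show ?thesis using less.prems(3)
    proof cases
      case longest': longest
      then show ?thesis using longest by simp
    next
      case (ascent i g)
      then show ?thesis using no_asc longest by blast
    qed
  next
    case (ascent i g)
    note asc = this
    show ?thesis using less.prems(3)
    proof cases
      case longest
      then show ?thesis using no_asc asc by blast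
    next
      case (ascent j g')
      then show ?thesis using asc main[of i j g g'] main[of j i g' g] by (cases "i \<le> j") auto
    qed
  qed
qed

lemma grothendieck_unique_exists:
  "w permutes {1..n} \<Longrightarrow> \<exists>!f. is_grothendieck n w f"
  using is_grothendieck_exists is_grothendieck_unique by blast

lemma is_grothendieck_grothendieck:
  "w permutes {1..n} \<Longrightarrow> is_grothendieck n w (grothendieck n w)"
  unfolding grothendieck_def by (rule theI'[OF grothendieck_unique_exists])

lemma grothendieck_longest:
  "grothendieck n (longest_perm n) = (\<Prod>(i, j) | 1 \<le> i \<and> 1 \<le> j \<and> i + j \<le> n. var i)"
  using is_grothendieck_unique[OF longest_perm_permutes] is_grothendieck.longest
    is_grothendieck_grothendieck[OF longest_perm_permutes] by blast

lemma grothendieck_ascent: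
  assumes "w permutes {1..n}" "1 \<le> i" "i < n" "w i < w (Suc i)"
  shows "grothendieck n w = \<pi> i (grothendieck n (w \<circ> transpose i (Suc i)))"
  using is_grothendieck_unique[OF assms(1)] is_grothendieck_grothendieck[OF assms(1)]
    is_grothendieck.ascent[OF is_grothendieck_grothendieck[OF permutes_transpose_Suc]] assms
  by blast

end

(*
Encode w by the word z of its inverse, so that the letters of z are the indices of the variables.
Removing the smallest letter m of z = xs m ys expresses G(z) through the words obtained by
sorting ys partially: this is the first row of a pipe dream, i.e. the first factor of the Fomin-Kirillov
product in the 0-Hecke algebra, and the recursion by divided differences follows from the
Yang-Baxter equation.

With all signs made positive, the expansion has nonnegative coefficients, so "zero-one" means that no
monomial is produced twice. Two descents in ys produce the monomials of G(xs ys) twice; hence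
ys has at most one descent l i, and comparing G(xs ys) with the polynomial of the word in which l i is
sorted restricts the letters smaller than i. What remains forces
G(z) = monomial * factor * G(shorter word), where the factor is in disjoint variables and is either
1 - prod (1 - x_q) or h_k(x_m, x_i) - x_m x_i h_(k-1)(x_m, x_i). Both have the asserted properties,
which are inherited by products in disjoint variables and by monomial multiples.
*)
theory Submission
  imports Defs
begin

section \<open>The 0-Hecke action on words\<close>

text \<open>Passing to inverse words separates two commuting actions: the factors of the
  Fomin-Kirillov product exchange positions of the word, whereas a divided difference exchanges the
  letters i and i+1. A statement about these two letters therefore passes through every row that
  does not carry their variables. The letters need not be 1, ..., n, so that deleting a letter stays
  within the class and leaves the other variables unchanged.

  The sign of a coefficient depends only on the degree of its monomial, which is why b = 1 yields
  absolute values; a lower bound for a coefficient is then obtained by exhibiting terms. The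
  obstacle is that the supports are not known explicitly. The only monomials exhibited are the
  Lehmer code, which always occurs, and the code changed by one added crossing or one ladder move.
  If l i is a descent behind the smallest letter m, the polynomials of the words with l i and with i
  l enter with the same power of x_m, so their supports must be disjoint. Testing this on the few
  monomials above is enough to force the shape of the word.\<close>

definition swap_adj :: "nat \<Rightarrow> 'a list \<Rightarrow> 'a list" where
  "swap_adj j z = z[j := z ! Suc j, Suc j := z ! j]"

definition adj_descent :: "nat \<Rightarrow> 'a::linorder list \<Rightarrow> bool" where
  "adj_descent j z \<longleftrightarrow> Suc j < length z \<and> z ! Suc j < z ! j"

text \<open>
  The parameter \<open>b\<close> is \<open>-1\<close> for Grothendieck polynomials; \<open>b = 1\<close> gives the absolute values of
  their coefficients.
\<close>

definition hecke_gen :: "'b \<Rightarrow> nat \<Rightarrow> ('a::linorder list \<Rightarrow> 'b) \<Rightarrow> 'a list \<Rightarrow> 'b::comm_ring_1" where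
  "hecke_gen b j F z = (if adj_descent j z then F (swap_adj j z) + b * F z else 0)"

definition hecke_step :: "'b \<Rightarrow> 'b \<Rightarrow> nat \<Rightarrow> ('a::linorder list \<Rightarrow> 'b) \<Rightarrow> 'a list \<Rightarrow> 'b::comm_ring_1" where
  "hecke_step b x j F z = F z + x * hecke_gen b j F z"

text \<open>The factor at the largest position is outermost and so acts on the word first. Within
  one row a letter can therefore travel arbitrarily far to the left, but at most one place to the
  right.\<close>

primrec hecke_row ::
  "'b \<Rightarrow> 'b \<Rightarrow> nat \<Rightarrow> nat \<Rightarrow> ('a::linorder list \<Rightarrow> 'b) \<Rightarrow> 'a list \<Rightarrow> 'b::comm_ring_1" where
  "hecke_row b x i 0 F = F"
| "hecke_row b x i (Suc r) F = hecke_step b x (i + r) (hecke_row b x i r F)"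

lemma length_swap_adj [simp]: "length (swap_adj j z) = length z"
  by (simp add: swap_adj_def)

lemma swap_adj_append: "length p = j \<Longrightarrow> swap_adj j (p @ a # b # q) = p @ b # a # q"
  by (auto simp: swap_adj_def nth_append list_update_append)

lemma adj_descent_append: "length p = j \<Longrightarrow> adj_descent j (p @ a # b # q) \<longleftrightarrow> b < a"
  by (auto simp: adj_descent_def nth_append)

lemma split_adj:
  assumes "Suc j < length z"
  obtains p a b q where "z = p @ a # b # q" "length p = j"
proof
  show "z = take j z @ z ! j # z ! Suc j # drop (Suc (Suc j)) z"
    using assms by (simp add: Cons_nth_drop_Suc Suc_lessD)
qed (use assms in simp)

lemma adj_descentE:
  assumes "adj_descent j z"
  obtains p a b q where "z = p @ a # b # q" "length p = j" "b < a"
  using assms by (metis adj_descent_append adj_descent_def split_adj)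

lemma mset_swap_adj: "Suc j < length z \<Longrightarrow> mset (swap_adj j z) = mset z"
  by (erule split_adj) (simp add: swap_adj_append)

lemma hecke_gen_add: "hecke_gen b j (\<lambda>z. F z + G z) = (\<lambda>z. hecke_gen b j F z + hecke_gen b j G z)"
  by (simp add: hecke_gen_def fun_eq_iff algebra_simps)

lemma hecke_gen_diff: "hecke_gen b j (\<lambda>z. F z - G z) = (\<lambda>z. hecke_gen b j F z - hecke_gen b j G z)"
  by (simp add: hecke_gen_def fun_eq_iff algebra_simps)

lemma hecke_gen_mult: "hecke_gen b j (\<lambda>z. c * F z) = (\<lambda>z. c * hecke_gen b j F z)"
  by (simp add: hecke_gen_def fun_eq_iff algebra_simps)

text \<open>For b = -1 the operator is S - 1, where S evaluates F at the word sorted in positions j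
  and j+1. As S is idempotent, the square of S - 1 is its negative.\<close>

lemma hecke_gen_quadratic:
  fixes F :: "'a::linorder list \<Rightarrow> 'b::comm_ring_1"
  shows "hecke_gen (- 1) j (hecke_gen (- 1) j F) = (\<lambda>z. - hecke_gen (- 1) j F z)"
proof
  fix z :: "'a list"
  have "\<not> adj_descent j (swap_adj j z)" if "adj_descent j z"
    using that by (elim adj_descentE) (simp add: swap_adj_append adj_descent_append)
  then show "hecke_gen (- 1) j (hecke_gen (- 1) j F) z = - hecke_gen (- 1) j F z"
    by (simp add: hecke_gen_def)
qed

lemma hecke_gen_commute:
  fixes F :: "'a::linorder list \<Rightarrow> 'b::comm_ring_1"
  assumes "Suc i < j"
  shows "hecke_gen b i (hecke_gen b j F) = hecke_gen b j (hecke_gen b i F)"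
proof
  fix z :: "'a list"
  have "adj_descent j (swap_adj i z) = adj_descent j z" "adj_descent i (swap_adj j z) = adj_descent i z"
    "swap_adj i (swap_adj j z) = swap_adj j (swap_adj i z)"
    using assms by (auto simp: adj_descent_def swap_adj_def list_update_swap nth_list_update)
  then show "hecke_gen b i (hecke_gen b j F) z = hecke_gen b j (hecke_gen b i F) z"
    by (simp add: hecke_gen_def algebra_simps)
qed

text \<open>With S and T the sorting operators at the two positions, (S - 1)(T - 1)(S - 1) = STS -
  ST - TS + S + T - 1, and STS = TST because both sort three adjacent letters.\<close>

lemma hecke_gen_braid:
  fixes F :: "'a::linorder list \<Rightarrow> 'b::comm_ring_1"
  shows "hecke_gen (- 1) i (hecke_gen (- 1) (Suc i) (hecke_gen (- 1) i F))
     = hecke_gen (- 1) (Suc i) (hecke_gen (- 1) i (hecke_gen (- 1) (Suc i) F))"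
proof
  fix z :: "'a list"
  show "hecke_gen (- 1) i (hecke_gen (- 1) (Suc i) (hecke_gen (- 1) i F)) z
     = hecke_gen (- 1) (Suc i) (hecke_gen (- 1) i (hecke_gen (- 1) (Suc i) F)) z"
  proof (cases "Suc (Suc i) < length z")
    case True
    then obtain p a b t where z0: "z = p @ a # b # t" "length p = i"
      by (elim split_adj[OF Suc_lessD])
    with True obtain c q where z: "z = p @ a # b # c # q" by (cases t) auto
    have s: "swap_adj i (p @ a # b # c # q) = p @ b # a # c # q"
      "swap_adj (Suc i) (p @ a # b # c # q) = p @ a # c # b # q"
      "adj_descent i (p @ a # b # c # q) \<longleftrightarrow> b < a"
      "adj_descent (Suc i) (p @ a # b # c # q) \<longleftrightarrow> c < b" for a b c
      using z0(2) swap_adj_append[of "p @ [a]" "Suc i" b c q] adj_descent_append[of "p @ [a]" "Suc i" b c q]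
      by (auto simp: swap_adj_append adj_descent_append)
    show ?thesis
      unfolding z by (auto simp: hecke_gen_def s)
  next
    case False
    then show ?thesis by (simp add: hecke_gen_def adj_descent_def)
  qed
qed

text \<open>The Yang--Baxter equation in a form that avoids the inverse of the last factor.\<close>

lemma hecke_step_yang_baxter:
  fixes x y :: "'b::comm_ring_1" and F :: "'a::linorder list \<Rightarrow> 'b" and i :: nat
  defines "u \<equiv> hecke_gen (- 1) i" and "v \<equiv> hecke_gen (- 1) (Suc i)"
  shows "hecke_step (- 1) x i (hecke_step (- 1) y (Suc i) (hecke_step (- 1) y i F))
    = hecke_step (- 1) y (Suc i) (\<lambda>z. F z + (x + y - x * y) * u F z + x * y * (u (v F) z - v (u F) z))"
proof -
  have q: "u (u G) = (\<lambda>z. - u G z)" "v (v G) = (\<lambda>z. - v G z)" "u (v (u G)) = v (u (v G))" for G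
    by (simp_all add: u_def v_def hecke_gen_quadratic hecke_gen_braid)
  have uv: "u (\<lambda>z. G z + H z) = (\<lambda>z. u G z + u H z)" "u (\<lambda>z. c * G z) = (\<lambda>z. c * u G z)"
     "v (\<lambda>z. G z + H z) = (\<lambda>z. v G z + v H z)" "v (\<lambda>z. c * G z) = (\<lambda>z. c * v G z)" 
     "v (\<lambda>z. G z - H z) = (\<lambda>z. v G z - v H z)" for c G H
    by (simp_all add: u_def v_def hecke_gen_add hecke_gen_mult hecke_gen_diff)
  have hs: "hecke_step (- 1) x i G = (\<lambda>z. G z + x * u G z)" "hecke_step (- 1) x (Suc i) G = (\<lambda>z. G z + x * v G z)" for x G
    by (simp_all add: hecke_step_def u_def v_def fun_eq_iff)
  have "v (u (v F)) = u (v (u F))" using q(3) by simp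
  then show ?thesis
    unfolding hs uv q by (simp add: fun_eq_iff algebra_simps)
qed

section \<open>Commuting rows\<close>

lemma hecke_step_eq: "hecke_step b x j F = (\<lambda>z. F z + x * hecke_gen b j F z)"
  by (simp add: hecke_step_def fun_eq_iff)

lemma hecke_step_commute:
  assumes "Suc i < j"
  shows "hecke_step b x i (hecke_step b y j F) = hecke_step b y j (hecke_step b x i F)"
  unfolding hecke_step_eq
  by (simp add: hecke_gen_add hecke_gen_mult hecke_gen_commute[OF assms] fun_eq_iff algebra_simps)

lemma hecke_row_Suc_inner: "hecke_row b x i (Suc r) F = hecke_row b x (Suc i) r (hecke_step b x i F)"
  by (induction r) simp_all

lemma hecke_step_row_commute:
  "Suc i < k \<Longrightarrow> hecke_step b x i (hecke_row b y k r F) = hecke_row b y k r (hecke_step b x i F)"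
proof (induction r)
  case (Suc r)
  then show ?case using hecke_step_commute[of i "k + r" b x y "hecke_row b y k r F"] by simp
qed simp

text \<open>The innermost factor of the x-row slides past the y-row from position i+2 on and meets
  the two innermost factors of that row. By the Yang-Baxter identity the three become one factor at
  i+1, which completes a y-row starting there, applied to an expression symmetric in x and y. Both
  rows are now shorter by one.\<close>

lemma hecke_row_commute:
  fixes x y :: "'b::comm_ring_1"
  shows "hecke_row (- 1) x i r (hecke_row (- 1) y i r F) = hecke_row (- 1) y i r (hecke_row (- 1) x i r F)"
proof (induction r arbitrary: i F)
  case 0
  then show ?case by simp
next
  case (Suc r)
  show ?case
  proof (cases r)
    case 0
    show ?thesis
      unfolding 0 by (simp add: hecke_step_eq hecke_gen_add hecke_gen_mult hecke_gen_quadratic fun_eq_iff algebra_simps)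
  next
    case r: (Suc s)
    have "hecke_row (- 1) x i (Suc r) (hecke_row (- 1) y i (Suc r) F)
      = hecke_row (- 1) x (Suc i) r (hecke_row (- 1) y (Suc i) r
          (\<lambda>z. F z + (x + y - x * y) * hecke_gen (- 1) i F z
            + x * y * (hecke_gen (- 1) i (hecke_gen (- 1) (Suc i) F) z
              - hecke_gen (- 1) (Suc i) (hecke_gen (- 1) i F) z)))" (is "?A x y = ?B x y") for x y
    proof -
      have "?A x y = hecke_row (- 1) x (Suc i) r (hecke_row (- 1) y (Suc (Suc i)) s
          (hecke_step (- 1) x i (hecke_step (- 1) y (Suc i) (hecke_step (- 1) y i F))))"
        by (simp only: r hecke_row_Suc_inner hecke_step_row_commute[OF lessI])
      then show ?thesis
        by (simp only: hecke_step_yang_baxter r hecke_row_Suc_inner)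
    qed
    note AB = this
    have "?B x y = ?B y x"
      by (subst Suc.IH) (simp only: mult.commute[of x y] add.commute[of x y])
    then show ?thesis
      by (simp only: AB[of x y] AB[of y x])
  qed
qed

section \<open>Word polynomials and their variables\<close>

text \<open>
  \<open>word_poly (- 1) z\<close> is the Grothendieck polynomial of the permutation whose inverse has the one-line
  notation \<open>z\<close>.
\<close>

primrec word_poly_aux :: "mpoly \<Rightarrow> nat \<Rightarrow> nat list \<Rightarrow> mpoly" where
  "word_poly_aux b 0 z = 1"
| "word_poly_aux b (Suc n) z = hecke_row b (var (Min (set z))) 0 n
     (\<lambda>y. if hd y = Min (set z) then word_poly_aux b n (tl y) else 0) z"

definition word_poly :: "mpoly \<Rightarrow> nat list \<Rightarrow> mpoly" where
  "word_poly b z = word_poly_aux b (length z) z"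

lemma hecke_row_cong:
  "(\<And>y. mset y = mset z \<Longrightarrow> F y = G y) \<Longrightarrow> hecke_row b x i r F z = hecke_row b x i r G z"
  by (induction r arbitrary: z) (simp_all add: hecke_step_def hecke_gen_def adj_descent_def mset_swap_adj)

lemma hecke_row_closed:
  assumes "\<And>y. mset y = mset z \<Longrightarrow> P (F y)" and "P 0" "P x" "P b"
    and "\<And>f g. P f \<Longrightarrow> P g \<Longrightarrow> P (f + g)" "\<And>f g. P f \<Longrightarrow> P g \<Longrightarrow> P (f * g)"
  shows "P (hecke_row b x i r F z)"
  using assms(1)
proof (induction r arbitrary: z)
  case (Suc r)
  then have "P (hecke_row b x i r F z)"
    "adj_descent (i + r) z \<Longrightarrow> P (hecke_row b x i r F (swap_adj (i + r) z))"
    by (simp_all add: adj_descent_def mset_swap_adj)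
  then show ?case by (auto simp: hecke_step_def hecke_gen_def intro!: assms)
qed simp

lemma word_poly_Nil [simp]: "word_poly b [] = 1"
  by (simp add: word_poly_def)

lemma word_poly_rec:
  assumes "z \<noteq> []" "m = Min (set z)"
  shows "word_poly b z = hecke_row b (var m) 0 (length z - 1)
     (\<lambda>y. if hd y = m then word_poly b (tl y) else 0) z"
proof -
  obtain n where n: "length z = Suc n" using assms(1) by (cases z) auto
  have "length y = Suc n" if "mset y = mset z" for y using that n by (metis size_mset)
  then show ?thesis
    unfolding word_poly_def n assms(2) by (auto intro!: hecke_row_cong)
qed

definition vars_in :: "nat set \<Rightarrow> mpoly \<Rightarrow> bool" where
  "vars_in V f \<longleftrightarrow> (\<forall>\<alpha>\<in>supp f. Poly_Mapping.keys \<alpha> \<subseteq> V)"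

lemma vars_in_mono: "vars_in V f \<Longrightarrow> V \<subseteq> W \<Longrightarrow> vars_in W f"
  by (auto simp: vars_in_def)

lemma vars_in_coeff_0: "vars_in V f \<Longrightarrow> k \<in> Poly_Mapping.keys \<alpha> \<Longrightarrow> k \<notin> V \<Longrightarrow> coeff f \<alpha> = 0"
  by (metis in_keys_iff subsetD vars_in_def)

lemma vars_in_0 [simp]: "vars_in V 0" and vars_in_1 [simp]: "vars_in V 1"
  and vars_in_minus [simp]: "vars_in V (- f) \<longleftrightarrow> vars_in V f"
  and vars_in_var [simp]: "vars_in V (var i) \<longleftrightarrow> i \<in> V"
  by (auto simp: vars_in_def var_def in_keys_iff)

lemma vars_in_add: "vars_in V f \<Longrightarrow> vars_in V g \<Longrightarrow> vars_in V (f + g)"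
  unfolding vars_in_def using keys_add[of f g] by blast

lemma vars_in_diff: "vars_in V f \<Longrightarrow> vars_in V g \<Longrightarrow> vars_in V (f - g)"
  using vars_in_add[of V f "- g"] by simp

lemma vars_in_mult: "vars_in V f \<Longrightarrow> vars_in V g \<Longrightarrow> vars_in V (f * g)"
  unfolding vars_in_def
proof
  fix \<alpha> assume fg: "\<forall>\<alpha>\<in>supp f. Poly_Mapping.keys \<alpha> \<subseteq> V" "\<forall>\<alpha>\<in>supp g. Poly_Mapping.keys \<alpha> \<subseteq> V" and "\<alpha> \<in> supp (f * g)"
  then obtain \<beta> \<gamma> where "\<alpha> = \<beta> + \<gamma>" "\<beta> \<in> supp f" "\<gamma> \<in> supp g"
    using keys_mult[of f g] by blast
  then show "Poly_Mapping.keys \<alpha> \<subseteq> V" using fg keys_add[of \<beta> \<gamma>] by blast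
qed

lemma vars_in_power: "vars_in V f \<Longrightarrow> vars_in V (f ^ n)"
  by (induction n) (auto intro: vars_in_mult)

lemma vars_in_word_poly: "vars_in {} b \<Longrightarrow> vars_in (set z) (word_poly b z)"
proof (induction "length z" arbitrary: z)
  case (Suc n)
  then have z: "z \<noteq> []" by auto
  have "vars_in (set z) (if hd y = Min (set z) then word_poly b (tl y) else 0)" if "mset y = mset z" for y
  proof -
    have y: "set y = set z" "length y = length z" using that by (metis set_mset_mset, metis size_mset)
    then have "vars_in (set (tl y)) (word_poly b (tl y))" using Suc by simp
    moreover have "set (tl y) \<subseteq> set z" using y z by (metis length_0_conv list.set_sel(2) subsetI)
    ultimately show ?thesis by (auto intro: vars_in_mono)
  qed
  then show ?case
    unfolding word_poly_rec[OF z refl]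
    by (rule hecke_row_closed) (use z Suc.prems in \<open>auto intro: vars_in_add vars_in_mult vars_in_mono\<close>)
qed simp

lemma swap_vars_invariant:
  assumes "vars_in V f" "i \<notin> V" "Suc i \<notin> V"
  shows "swap_vars i f = f"
proof (rule poly_mapping_eqI)
  fix \<alpha>
  let ?t = "Poly_Mapping.map_key (transpose i (Suc i)) :: expvec \<Rightarrow> expvec"
  have l: "coeff (swap_vars i f) \<alpha> = coeff f (?t \<alpha>)"
    by (simp add: swap_vars_def map_key.rep_eq inj_map_key_transpose)
  have lt: "Poly_Mapping.lookup (?t \<alpha>) k = Poly_Mapping.lookup \<alpha> (transpose i (Suc i) k)" for k
    by (simp add: map_key.rep_eq)
  show "coeff (swap_vars i f) \<alpha> = coeff f \<alpha>"
  proof (cases "Poly_Mapping.keys \<alpha> \<inter> {i, Suc i} = {}")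
    case True
    then have "?t \<alpha> = \<alpha>"
      by (intro poly_mapping_eqI) (simp add: lt transpose_def in_keys_iff)
    then show ?thesis using l by simp
  next
    case False
    then have "Poly_Mapping.keys (?t \<alpha>) \<inter> {i, Suc i} \<noteq> {}"
      by (auto simp: lt in_keys_iff)
    then have "coeff f \<alpha> = 0" "coeff f (?t \<alpha>) = 0"
      using assms False by (auto intro: vars_in_coeff_0)
    then show ?thesis using l by simp
  qed
qed

section \<open>The recursion\<close>

primrec before :: "'a \<Rightarrow> 'a \<Rightarrow> 'a list \<Rightarrow> bool" where
  "before x y [] \<longleftrightarrow> False"
| "before x y (c # q) \<longleftrightarrow> before x y q \<or> (x = c \<and> y \<in> set q)"

lemma before_append:
  "before x y (p @ q) \<longleftrightarrow> before x y p \<or> before x y q \<or> (x \<in> set p \<and> y \<in> set q)"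
  by (induction p) auto

lemma before_set: "before x y z \<Longrightarrow> x \<in> set z \<and> y \<in> set z"
  by (induction z) auto

lemma before_map: "inj f \<Longrightarrow> before (f x) (f y) (map f z) \<longleftrightarrow> before x y z"
  by (induction z) (auto simp: inj_image_mem_iff inj_eq)

lemma before_total:
  "x \<in> set z \<Longrightarrow> y \<in> set z \<Longrightarrow> x \<noteq> y \<Longrightarrow> distinct z \<Longrightarrow> before x y z \<longleftrightarrow> \<not> before y x z"
  by (induction z) (auto dest: before_set)

definition relabel :: "nat \<Rightarrow> nat list \<Rightarrow> nat list" where
  "relabel i z = map (transpose i (Suc i)) z"

text \<open>The analogue of \<open>hecke_gen (- 1)\<close> for values in place of positions; the two
  correspond to multiplying the permutation on opposite sides.\<close>

definition value_gen :: "nat \<Rightarrow> (nat list \<Rightarrow> 'b) \<Rightarrow> nat list \<Rightarrow> 'b::comm_ring_1" where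
  "value_gen i F z = (if before (Suc i) i z then F (relabel i z) - F z else 0)"

lemma mset_relabel:
  assumes "distinct z" "i \<in> set z" "Suc i \<in> set z"
  shows "mset (relabel i z) = mset z"
proof -
  have "set (relabel i z) = set z"
    using assms by (auto simp: relabel_def transpose_def image_iff)
  moreover have "distinct (relabel i z)"
    using assms(1) by (auto simp: relabel_def distinct_map intro!: inj_onI dest: transpose_eq_imp_eq)
  ultimately show ?thesis
    using assms(1) set_eq_iff_mset_eq_distinct by blast
qed

lemma relabel_relabel [simp]: "relabel i (relabel i z) = z"
  by (simp add: relabel_def)

lemma before_relabel:
  "before (Suc i) i (relabel i z) \<longleftrightarrow> before i (Suc i) z"
  using before_map[of "transpose i (Suc i)" i "Suc i" z] by (simp add: relabel_def)

text \<open>Exchanging the letters i and i+1 affects no comparison with another letter, and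
  exchanging two adjacent positions does not change which of i, i+1 comes first, unless these two
  letters occupy the positions j and j+1. In that case both operators vanish at z, or both lead from
  z to the same word.\<close>

lemma value_gen_hecke_gen_commute:
  assumes "distinct z"
  shows "value_gen i (hecke_gen (- 1) j F) z = hecke_gen (- 1) j (value_gen i F) z"
proof (cases "Suc j < length z")
  case True
  let ?t = "transpose i (Suc i)"
  obtain p a b q where z: "z = p @ a # b # q" and p: "length p = j" using True by (rule split_adj)
  have s: "swap_adj j z = p @ b # a # q" "adj_descent j z \<longleftrightarrow> b < a"
    "adj_descent j (relabel i z) \<longleftrightarrow> ?t b < ?t a"
    "swap_adj j (relabel i z) = relabel i (p @ b # a # q)"
    by (simp_all add: z relabel_def swap_adj_append adj_descent_append p)
  have d: "a \<noteq> b" "a \<notin> set p" "b \<notin> set p" "a \<notin> set q" "b \<notin> set q" using assms z by auto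
  consider "a = i" "b = Suc i" | "a = Suc i" "b = i"
    | "\<not> (a = i \<and> b = Suc i)" "\<not> (a = Suc i \<and> b = i)" by blast
  then show ?thesis
  proof cases
    case 1
    then have "\<not> before (Suc i) i z" using d by (auto simp: z before_append dest: before_set)
    then show ?thesis using 1 by (simp add: value_gen_def hecke_gen_def s)
  next
    case 2
    then have b: "before (Suc i) i z" "\<not> before (Suc i) i (p @ b # a # q)"
      using d by (auto simp: z before_append dest: before_set)
    have "relabel i z = p @ b # a # q"
      using 2 d by (auto simp: z relabel_def transpose_def intro!: map_idI)
    then show ?thesis using 2 b by (simp add: value_gen_def hecke_gen_def s) (simp add: adj_descent_append p)
  next
    case 3
    then have "?t b < ?t a \<longleftrightarrow> b < a" using d(1) by (auto simp: transpose_def)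
    moreover have "before (Suc i) i (p @ b # a # q) \<longleftrightarrow> before (Suc i) i z"
      using 3 by (auto simp: z before_append)
    ultimately show ?thesis by (simp add: value_gen_def hecke_gen_def s)
  qed
next
  case False
  then show ?thesis by (simp add: value_gen_def hecke_gen_def adj_descent_def relabel_def)
qed

section \<open>Symmetry in two consecutive variables\<close>

text \<open>
  Invariance of the following polynomials under \<open>swap_vars i\<close> is equivalent to the recursion by \<open>\<pi> i\<close>,
  and unlike the latter it is visibly compatible with \<open>hecke_row\<close>.
\<close>

definition symmetrization :: "nat \<Rightarrow> (nat list \<Rightarrow> mpoly) \<Rightarrow> nat list \<Rightarrow> mpoly" where
  "symmetrization i F z = F z + var (Suc i) * value_gen i F z"

lemma symmetrization_eq: "symmetrization i F = (\<lambda>z. F z + var (Suc i) * value_gen i F z)"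
  by (simp add: symmetrization_def fun_eq_iff)

lemma symmetrization_hecke_row:
  "distinct z \<Longrightarrow>
     symmetrization i (hecke_row (- 1) x j r F) z = hecke_row (- 1) x j r (symmetrization i F) z"
proof (induction r arbitrary: z)
  case (Suc r)
  let ?G = "hecke_row (- 1) x j r F"
  have 1: "symmetrization i (hecke_step (- 1) x k G) z = hecke_step (- 1) x k (symmetrization i G) z" for k G
  proof -
    have "value_gen i (hecke_step (- 1) x k G) z = value_gen i G z + x * value_gen i (hecke_gen (- 1) k G) z"
      by (simp add: value_gen_def hecke_step_def algebra_simps)
    then show ?thesis
      by (simp only: symmetrization_eq hecke_gen_add hecke_gen_mult hecke_step_eq
          value_gen_hecke_gen_commute[OF Suc.prems] distrib_left mult_ac add_ac)
  qed
  have 2: "hecke_step (- 1) x k (symmetrization i ?G) z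
      = hecke_step (- 1) x k (hecke_row (- 1) x j r (symmetrization i F)) z" for k
  proof -
    have "distinct (swap_adj k z)" if "adj_descent k z"
      using Suc.prems that mset_eq_imp_distinct_iff[OF mset_swap_adj[of k z]] by (simp add: adj_descent_def)
    then show ?thesis using Suc by (simp add: hecke_step_def hecke_gen_def)
  qed
  show ?case by (simp only: hecke_row.simps 1 2)
qed simp

lemma swap_vars_hecke_row:
  "swap_vars i (hecke_row (- 1) x j r F z) = hecke_row (- 1) (swap_vars i x) j r (\<lambda>y. swap_vars i (F y)) z"
proof (induction r arbitrary: z)
  case (Suc r)
  have "swap_vars i 0 = 0" using swap_vars_minus[of i 0 0] by simp
  moreover from this have "swap_vars i (- f) = - swap_vars i f" for f using swap_vars_minus[of i 0 f] by simp
  ultimately show ?case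
    by (simp add: hecke_step_def hecke_gen_def swap_vars_add swap_vars_minus swap_vars_mult Suc)
qed simp

text \<open>A row that starts at position 1 or later never moves the first letter.\<close>

lemma hecke_row_Cons:
  fixes t :: "nat list"
  shows "hecke_row b x (Suc i) r (\<lambda>y. if hd y = c then F (tl y) else 0) (d # t)
     = (if d = c then hecke_row b x i r F t else 0)"
proof (induction r arbitrary: d t)
  case (Suc r)
  have "adj_descent (Suc j) (d # t) \<longleftrightarrow> adj_descent j t" "swap_adj (Suc j) (d # t) = d # swap_adj j t"
    for j d and t :: "nat list"
    by (simp_all add: adj_descent_def swap_adj_def)
  then show ?case using Suc by (simp add: hecke_step_def hecke_gen_def)
qed simp

text \<open>If the smallest letter m is below i, the first row involves neither variable and the
  claim passes to the tail. If m = i, the first two rows carry x_i and x_(i+1). The second is one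
  factor short, because position 0 holds i, and \<open>symmetrization\<close> supplies exactly this
  factor. Exchanging the variables then exchanges two full rows, which commute.\<close>

lemma symmetric_word_poly:
  "distinct z \<Longrightarrow> i \<in> set z \<Longrightarrow> Suc i \<in> set z \<Longrightarrow>
     swap_vars i (symmetrization i (word_poly (- 1)) z) = symmetrization i (word_poly (- 1)) z"
proof (induction "length z" arbitrary: z)
  case 0
  then show ?case by simp
next
  case (Suc n)
  define m where "m = Min (set z)"
  define F where "F = (\<lambda>y. if hd y = m then word_poly (- 1) (tl y) else 0)"
  let ?E = "hecke_row (- 1) (var m) 0 n F"
  have n: "length z = Suc n" and z: "z \<noteq> []" using Suc.hyps(2) by auto
  have E: "word_poly (- 1) y = ?E y" if "mset y = mset z" for y
  proof -
    have "set y = set z" "length y = Suc n" using that n by (metis set_mset_mset, metis size_mset)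
    moreover from this have "y \<noteq> []" by auto
    ultimately show ?thesis using word_poly_rec[of y m "- 1"] by (simp add: F_def m_def)
  qed
  have "symmetrization i (word_poly (- 1)) z = symmetrization i ?E z"
    using E[OF refl] E[OF mset_relabel] Suc.prems by (simp add: symmetrization_def value_gen_def)
  also have "\<dots> = hecke_row (- 1) (var m) 0 n (symmetrization i F) z"
    by (rule symmetrization_hecke_row) fact
  finally have K: "symmetrization i (word_poly (- 1)) z = hecke_row (- 1) (var m) 0 n (symmetrization i F) z" .
  have m: "m \<in> set z" "\<And>k. k \<in> set z \<Longrightarrow> m \<le> k" using z by (auto simp: m_def)
  have hd_tl: "y \<noteq> []" "set (tl y) = set z - {hd y}" "distinct y" "length (tl y) = n" "hd y \<in> set z"
    if "mset y = mset z" for y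
  proof -
    have sy: "set y = set z" "length y = Suc n" and dy: "distinct y"
      using that n Suc.prems(1) by (metis set_mset_mset, metis size_mset, metis mset_eq_imp_distinct_iff)
    then obtain c t where y: "y = c # t" by (cases y) auto
    then show "y \<noteq> []" "set (tl y) = set z - {hd y}" "distinct y" "length (tl y) = n" "hd y \<in> set z"
      using sy dy by auto
  qed
  show ?case
  proof (cases "m = i")
    case False
    then have lt: "m < i" using m Suc.prems by (metis le_neq_implies_less)
    \<comment> \<open>Relabelling fixes m because m < i, so the condition on the first letter is
      unaffected.\<close>
    have F: "symmetrization i F y = (if hd y = m then symmetrization i (word_poly (- 1)) (tl y) else 0)"
      if yz: "mset y = mset z" for y
    proof -
      obtain c t where y: "y = c # t" using hd_tl(1)[OF yz] by (cases y) auto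
      have "transpose i (Suc i) c = m \<longleftrightarrow> c = m"
        using lt by (auto simp: transpose_def)
      moreover have "transpose i (Suc i) m = m"
        using lt by (auto simp: transpose_def)
      ultimately show ?thesis
        using lt by (auto simp: y symmetrization_def value_gen_def F_def relabel_def)
    qed
    have "swap_vars i (symmetrization i F y) = symmetrization i F y" if y: "mset y = mset z" for y
    proof (cases "hd y = m")
      case True
      have "swap_vars i (symmetrization i (word_poly (- 1)) (tl y)) = symmetrization i (word_poly (- 1)) (tl y)"
      proof (rule Suc.hyps(1))
        show "n = length (tl y)" "i \<in> set (tl y)" "Suc i \<in> set (tl y)" "distinct (tl y)"
          using hd_tl[OF y] True lt Suc.prems by (auto simp: distinct_tl)
      qed
      then show ?thesis using F[OF y] True by simp
    next
      case False
      then show ?thesis using F[OF y] swap_vars_minus[of i 0 0] by simp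
    qed
    moreover have "swap_vars i (var m) = var m"
      using lt by (simp add: swap_vars_var transpose_def)
    ultimately show ?thesis
      unfolding K swap_vars_hecke_row by (auto intro: hecke_row_cong)
  next
    case True
    define F2 where "F2 = (\<lambda>y. if hd y = Suc i then word_poly (- 1) (tl y) else 0)"
    \<comment> \<open>Among the rearrangements of z it is supported on those starting with i, i+1,
      and it is free of x_i and x_(i+1): the common seed of the two rows.\<close>
    define F3 where "F3 = (\<lambda>y. if hd y = i then F2 (tl y) else 0)"
    obtain n' where n': "n = Suc n'"
      using n Suc.prems by (cases n; cases z) auto
    have F: "F y = hecke_row (- 1) (var (Suc i)) (Suc 0) n' F3 y" if y: "mset y = mset z" for y
    proof -
      have "word_poly (- 1) (tl y) = hecke_row (- 1) (var (Suc i)) 0 n' F2 (tl y)" if "hd y = i"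
      proof -
        have st: "set (tl y) = set z - {i}" using hd_tl[OF y] that by simp
        have "Min (set (tl y)) = Suc i"
          unfolding st
        proof (rule Min_eqI)
          fix k assume "k \<in> set z - {i}"
          then show "Suc i \<le> k" using m(2)[of k] True by auto
        qed (use Suc.prems in auto)
        moreover have "length (tl y) = Suc n'" using hd_tl(4)[OF y] n' by simp
        moreover from this have "tl y \<noteq> []" by (metis length_0_conv nat.distinct(1))
        ultimately show ?thesis using word_poly_rec[of "tl y" "Suc i" "- 1"] by (simp add: F2_def)
      qed
      moreover obtain c t where "y = c # t" using hd_tl(1)[OF y] by (cases y) auto
      ultimately show ?thesis
        using hecke_row_Cons[of "- 1" "var (Suc i)" 0 n' i F2 c t] True
        by (simp add: F_def F3_def)
    qed
    \<comment> \<open>On a function with this support, exchanging the letters i and i+1 amounts to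
      exchanging positions 0 and 1.\<close>
    have F3: "symmetrization i F3 y = hecke_step (- 1) (var (Suc i)) 0 F3 y" if y: "mset y = mset z" for y
    proof -
      have "length y = Suc (Suc n')" using y n n' by (metis size_mset)
      then obtain c d t where cdt: "y = c # d # t" by (metis Suc_length_conv)
      have dy: "distinct (c # d # t)" using hd_tl(3)[OF y] cdt by simp
      have F3c: "F3 (c # d # t) = (if c = i \<and> d = Suc i then word_poly (- 1) t else 0)" for c d t
        by (simp add: F3_def F2_def)
      have s: "swap_adj 0 y = d # c # t" "adj_descent 0 y \<longleftrightarrow> d < c"
        by (simp_all add: cdt swap_adj_def adj_descent_def)
      consider "c = Suc i" "d = i" | "c = i" "d = Suc i" | "F3 (c # d # t) = 0" "F3 (d # c # t) = 0" "F3 (relabel i y) = 0"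
      proof (cases "{c, d} = {i, Suc i}")
        case False
        then have "F3 (relabel i y) = 0" "F3 (c # d # t) = 0" "F3 (d # c # t) = 0"
          by (auto simp: cdt F3c relabel_def transpose_def)
        then show ?thesis using that by blast
      qed (use that in \<open>auto simp: doubleton_eq_iff\<close>)
      then have "value_gen i F3 y = hecke_gen (- 1) 0 F3 y"
      proof cases
        case 1
        then have "relabel i y = d # c # t" "before (Suc i) i y" "d < c"
          using dy by (auto simp: cdt relabel_def transpose_def intro!: map_idI)
        then show ?thesis by (simp add: value_gen_def hecke_gen_def s)
      next
        case 2
        then have "\<not> before (Suc i) i y"
          using dy by (auto simp: cdt dest: before_set)
        then show ?thesis using 2 by (simp add: value_gen_def hecke_gen_def s)
      next
        case 3
        then show ?thesis by (simp add: value_gen_def hecke_gen_def s) (simp add: cdt)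
      qed
      then show ?thesis by (simp add: symmetrization_def hecke_step_def)
    qed
    have F3s: "swap_vars i (F3 y) = F3 y" if y: "mset y = mset z" for y
    proof (cases "hd y = i \<and> hd (tl y) = Suc i")
      case True
      obtain d t where dt: "tl y = d # t" using hd_tl(4)[OF y] n' by (cases "tl y") auto
      have "distinct (tl y)" using hd_tl[OF y] by (simp add: distinct_tl)
      then have "hd (tl y) \<notin> set (tl (tl y))" "set (tl (tl y)) \<subseteq> set (tl y)"
        unfolding dt by auto
      then have "i \<notin> set (tl (tl y))" "Suc i \<notin> set (tl (tl y))"
        using hd_tl(2)[OF y] True by auto
      then have "swap_vars i (word_poly (- 1) (tl (tl y))) = word_poly (- 1) (tl (tl y))"
        by (intro swap_vars_invariant[OF vars_in_word_poly]) auto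
      then show ?thesis using True by (simp add: F3_def F2_def)
    next
      case False
      then show ?thesis using swap_vars_minus[of i 0 0] by (auto simp: F3_def F2_def)
    qed
    have "symmetrization i F y = hecke_row (- 1) (var (Suc i)) 0 n F3 y" if y: "mset y = mset z" for y
    proof -
      have "symmetrization i F y = symmetrization i (hecke_row (- 1) (var (Suc i)) (Suc 0) n' F3) y"
        using F[OF y] F[of "relabel i y"] hd_tl[OF y] Suc.prems y mset_relabel[of y i]
        by (simp add: symmetrization_def value_gen_def) (metis before_set set_mset_mset)
      also have "\<dots> = hecke_row (- 1) (var (Suc i)) (Suc 0) n' (symmetrization i F3) y"
        using hd_tl[OF y] by (intro symmetrization_hecke_row)
      also have "\<dots> = hecke_row (- 1) (var (Suc i)) (Suc 0) n' (hecke_step (- 1) (var (Suc i)) 0 F3) y"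
        using F3 y by (intro hecke_row_cong) simp
      finally show ?thesis by (simp only: n' hecke_row_Suc_inner)
    qed
    then have "symmetrization i (word_poly (- 1)) z
        = hecke_row (- 1) (var i) 0 n (hecke_row (- 1) (var (Suc i)) 0 n F3) z"
      unfolding K True by (intro hecke_row_cong)
    \<comment> \<open>The exchange of variables turns the row of x_i into that of x_(i+1) and
      conversely, and it fixes the seed.\<close>
    moreover have "swap_vars i \<dots> = hecke_row (- 1) (var (Suc i)) 0 n (hecke_row (- 1) (var i) 0 n F3) z"
    proof -
      have "swap_vars i (hecke_row (- 1) (var (Suc i)) 0 n F3 y) = hecke_row (- 1) (var i) 0 n F3 y"
        if y: "mset y = mset z" for y
        unfolding swap_vars_hecke_row using F3s y by (auto simp: swap_vars_var intro!: hecke_row_cong)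
      then show ?thesis
        unfolding swap_vars_hecke_row[of i "var i"] by (auto simp: swap_vars_var intro!: hecke_row_cong)
    qed
    ultimately show ?thesis by (simp only: hecke_row_commute)
  qed
qed

text \<open>As i already precedes i+1 in z, \<open>value_gen\<close> vanishes at z, so the
  polynomial g of z is itself symmetric. With f the polynomial of the relabelled word, the symmetry
  of f + x_(i+1) (g - f) reads (x_i - x_(i+1)) g = (1 - x_(i+1)) f - (1 - x_i) s_i f.\<close>

lemma word_poly_demazure:
  assumes "distinct z" "before i (Suc i) z"
  shows "word_poly (- 1) z = \<pi> i (word_poly (- 1) (relabel i z))"
proof -
  have iz: "i \<in> set z" "Suc i \<in> set z" using before_set[OF assms(2)] by auto
  let ?y = "relabel i z" and ?a = "var i" and ?b = "var (Suc i)"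
  have y: "distinct ?y" "set ?y = set z"
    using mset_relabel[OF assms(1) iz] assms(1) by (metis mset_eq_imp_distinct_iff, metis set_mset_mset)
  have nb: "\<not> before (Suc i) i z" using before_total[OF iz] assms by simp
  define f g where "f = word_poly (- 1) ?y" and "g = word_poly (- 1) z"
  have g: "swap_vars i g = g"
    using symmetric_word_poly[OF assms(1) iz] nb by (simp add: symmetrization_def value_gen_def g_def)
  have "swap_vars i (f + ?b * (g - f)) = f + ?b * (g - f)"
    using symmetric_word_poly[of ?y i] y iz assms(2)
    by (simp add: symmetrization_def value_gen_def g_def f_def before_relabel)
  then have "swap_vars i f + ?a * (g - swap_vars i f) = f + ?b * (g - f)"
    by (simp add: swap_vars_add swap_vars_mult swap_vars_minus swap_vars_var g)
  then have "(?a - ?b) * g = (?a - ?b) * \<pi> i f"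
    unfolding demazure_eq by algebra
  then show ?thesis
    using var_diff_nonzero[of i "Suc i"] by (simp add: f_def g_def)
qed

section \<open>Removing the smallest letter\<close>

text \<open>The outer factors act first, on z itself, and are trivial there.\<close>

lemma hecke_row_no_descent:
  assumes "\<And>k. i + s \<le> k \<Longrightarrow> k < i + r \<Longrightarrow> \<not> adj_descent k z" "s \<le> r"
  shows "hecke_row b x i r F z = hecke_row b x i s F z"
  using assms
proof (induction r)
  case (Suc r)
  show ?case
  proof (cases "s = Suc r")
    case False
    then have "\<not> adj_descent (i + r) z" "hecke_row b x i r F z = hecke_row b x i s F z"
      using Suc by auto
    then show ?thesis by (simp add: hecke_step_def hecke_gen_def)
  qed simp
qed simp

text \<open>The factors to the right of m rearrange \<open>ys\<close> alone, and the factor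
  comparing m with the head of \<open>ys\<close> is trivial. Each factor after that must exchange m
  with its left neighbour, since otherwise m cannot reach the front; every such move contributes one
  x_m.\<close>

lemma word_poly_append:
  assumes "\<forall>y\<in>set xs \<union> set ys. m < y"
  shows "word_poly b (xs @ m # ys)
    = var m ^ length xs * hecke_row b (var m) 0 (length ys - 1) (\<lambda>ys. word_poly b (xs @ ys)) ys"
proof -
  define F where "F = (\<lambda>y. if hd y = m then word_poly b (tl y) else 0)"
  let ?E = "\<lambda>j. hecke_row b (var m) 0 j F"
  \<comment> \<open>The remaining j factors touch only the first j + 1 letters, so m is not moved
    and the front letter differs from m.\<close>
  have zero: "?E j (xs @ m # ys) = 0" if "m \<notin> set xs" "j < length xs" for j xs ys
    using that
  proof (induction j arbitrary: xs ys)
    case 0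
    then have "hd (xs @ m # ys) \<noteq> m" by (cases xs) auto
    then show ?case by (simp add: F_def)
  next
    case (Suc j)
    obtain p c d q where xs: "xs = p @ c # d # q" "length p = j"
      using split_adj[OF Suc.prems(2)] by blast
    then have "hecke_row b (var m) 0 j F (p @ d # c # q @ m # ys) = 0"
      using Suc.IH[of "p @ d # c # q" ys] Suc.prems by simp
    then show ?case
      using Suc.IH[of xs ys] Suc.prems xs
      by (auto simp: hecke_step_def hecke_gen_def swap_adj_append)
  qed
  have first: "?E (length xs) (xs @ m # ys) = var m ^ length xs * word_poly b (xs @ ys)"
    if "\<forall>y\<in>set xs. m < y" for xs ys
    using that
  proof (induction xs arbitrary: ys rule: rev_induct)
    case Nil
    then show ?case by (simp add: F_def)
  next
    case (snoc c xs)
    have "?E (length xs) ((xs @ [c]) @ m # ys) = 0"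
      using snoc.prems by (intro zero) auto
    then show ?case
      using snoc.IH[of "c # ys"] snoc.prems
      by (simp add: hecke_step_def hecke_gen_def adj_descent_append swap_adj_append mult.assoc)
  qed
  have last: "?E (Suc (length xs) + r) (xs @ m # ys)
      = var m ^ length xs * hecke_row b (var m) 0 r (\<lambda>ys. word_poly b (xs @ ys)) ys"
    if "\<forall>y\<in>set xs \<union> set ys. m < y" for r ys
    using that
  proof (induction r arbitrary: ys)
    case 0
    have "\<not> adj_descent (length xs) (xs @ m # ys)"
      using 0 by (cases ys) (simp add: adj_descent_def, simp add: adj_descent_append not_less less_imp_le)
    then show ?case using first[of xs ys] 0 by (simp add: hecke_step_def hecke_gen_def)
  next
    case (Suc r)
    have d: "adj_descent (Suc (length xs) + r) (xs @ m # ys) \<longleftrightarrow> adj_descent r ys"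
      by (simp add: adj_descent_def nth_append)
    have s: "swap_adj (Suc (length xs) + r) (xs @ m # ys) = xs @ m # swap_adj r ys" "set (swap_adj r ys) = set ys"
      if "adj_descent r ys"
      using that
      by (elim adj_descentE, use swap_adj_append[of "xs @ m # p" "Suc (length xs) + r" for p] in \<open>simp add: swap_adj_append; fastforce\<close>)
        (metis adj_descent_def mset_swap_adj set_mset_mset that)
    show ?case
    proof (cases "adj_descent r ys")
      case True
      then show ?thesis
        using Suc.IH[of ys] Suc.IH[of "swap_adj r ys"] Suc.prems d s
        by (simp add: hecke_step_def hecke_gen_def algebra_simps)
    next
      case False
      then show ?thesis
        using Suc.IH[of ys] Suc.prems d by (simp add: hecke_step_def hecke_gen_def)
    qed
  qed
  have "Min (set (xs @ m # ys)) = m"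
    using assms by (intro Min_eqI) (auto simp: less_imp_le)
  then have "word_poly b (xs @ m # ys) = ?E (length xs + length ys) (xs @ m # ys)"
    using word_poly_rec[of "xs @ m # ys" m b] by (simp add: F_def)
  also have "\<dots> = var m ^ length xs * hecke_row b (var m) 0 (length ys - 1) (\<lambda>ys. word_poly b (xs @ ys)) ys"
  proof (cases ys)
    case Nil
    then show ?thesis using first[of xs ys] assms by simp
  next
    case (Cons y ys')
    then show ?thesis using last[of ys "length ys'"] assms by simp
  qed
  finally show ?thesis .
qed

lemma sorted_no_adj_descent: "sorted z \<Longrightarrow> \<not> adj_descent k z"
  by (metis adj_descent_def linorder_not_less sorted_iff_nth_Suc)

lemma no_adj_descent_sorted: "(\<And>k. \<not> adj_descent k z) \<Longrightarrow> sorted z"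
  by (metis adj_descent_def linorder_not_less sorted_iff_nth_Suc)

lemma word_poly_append_sorted:
  assumes "\<forall>y\<in>set xs \<union> set ys. m < y" "sorted ys"
  shows "word_poly b (xs @ m # ys) = var m ^ length xs * word_poly b (xs @ ys)"
  using word_poly_append[OF assms(1)]
    hecke_row_no_descent[of 0 0 "length ys - 1" ys b "var m"] sorted_no_adj_descent[OF assms(2)]
  by simp

section \<open>Grothendieck polynomials as word polynomials\<close>

lemma word_poly_rev_upt:
  "k \<le> Suc n \<Longrightarrow> word_poly b (rev [k..<Suc n]) = (\<Prod>i\<in>{k..n}. var i ^ (n - i))"
proof (induction k rule: inc_induct)
  case (step k)
  have "rev [k..<Suc n] = rev [Suc k..<Suc n] @ k # []"
    using step by (simp add: upt_conv_Cons del: upt_Suc)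
  then have "word_poly b (rev [k..<Suc n]) = var k ^ (n - k) * word_poly b (rev [Suc k..<Suc n])"
    using word_poly_append_sorted[of "rev [Suc k..<Suc n]" "[]" k b] by (simp del: upt_Suc)
  moreover have "{k..n} = insert k {Suc k..n}" using step by auto
  ultimately show ?case using step by (simp del: upt_Suc)
qed simp

text \<open>A letter of the inverse word is a position of w: exchanging w(i) and w(i+1) relabels the
  word, and an ascent of w at i puts i before i+1. For the longest permutation the word is
  decreasing, and each removal of the smallest letter contributes only a power of its
  variable.\<close>

lemma is_grothendieck_word_poly:
  "is_grothendieck n w f \<Longrightarrow> w permutes {1..n} \<Longrightarrow> f = word_poly (- 1) (map (inv w) [1..<Suc n])"
proof (induction rule: is_grothendieck.induct)
  case longest
  have inv: "inv (longest_perm n) = longest_perm n"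
    by (rule inv_unique_comp) (auto simp: longest_perm_def fun_eq_iff)
  have "map (longest_perm n) [1..<Suc n] = rev [1..<Suc n]"
    by (rule nth_equalityI) (simp_all add: longest_perm_def rev_nth del: upt_Suc)
  then have "word_poly (- 1) (map (inv (longest_perm n)) [1..<Suc n]) = (\<Prod>i\<in>{1..n}. \<Prod>j\<in>{1..n - i}. var i)"
    using word_poly_rev_upt[of 1 n "- 1"] inv by (simp del: upt_Suc)
  also have "\<dots> = (\<Prod>(i, j)\<in>(SIGMA i:{1..n}. {1..n - i}). var i)"
    by (rule prod.Sigma) auto
  also have "(SIGMA i:{1..n}. {1..n - i}) = {(i, j). 1 \<le> i \<and> 1 \<le> j \<and> i + j \<le> n}"
    by auto
  finally show ?case by simp
next
  case (ascent w i g)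
  let ?t = "transpose i (Suc i)" and ?z = "map (inv w) [1..<Suc n]"
  have wt: "w \<circ> ?t permutes {1..n}" using ascent by (intro permutes_transpose_Suc)
  have "inv (w \<circ> ?t) = ?t \<circ> inv w"
    using permutes_bij[OF ascent.prems] by (simp add: o_inv_distrib)
  then have g: "g = word_poly (- 1) (relabel i ?z)"
    using ascent.IH[OF wt] by (simp add: relabel_def comp_def)
  have d: "distinct ?z"
    using permutes_inj[OF permutes_inv[OF ascent.prems]] by (simp add: distinct_map inj_on_def)
  have "before i (Suc i) ?z"
  proof -
    define v where "v = w (Suc i)"
    have v: "w i \<in> {1..<v}" "v \<in> {v..<Suc n}" "1 \<le> v"
      using permutes_in_image[OF ascent.prems, of i] permutes_in_image[OF ascent.prems, of "Suc i"] ascent.hyps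
      by (auto simp: v_def)
    then have u: "[1..<Suc n] = [1..<v] @ [v..<Suc n]"
      using upt_add_eq_append[of 1 v "Suc n - v"] by (simp del: upt_Suc)
    have "inv w (w k) = k" for k using permutes_inverses(2)[OF ascent.prems] .
    then have "i \<in> inv w ` {1..<v}" "Suc i \<in> inv w ` {v..<Suc n}"
      using v by (metis image_eqI, metis image_eqI v_def)
    then show ?thesis unfolding u by (simp add: before_append del: upt_Suc)
  qed
  then show ?case using word_poly_demazure[OF d] g by simp
qed

lemma grothendieck_word_poly:
  "w permutes {1..n} \<Longrightarrow> grothendieck n w = word_poly (- 1) (map (inv w) [1..<Suc n])"
  using is_grothendieck_word_poly is_grothendieck_grothendieck by blast

section \<open>Signs and multiplicities\<close>

lemma coeff_var_mult:
  "coeff (var m * f) \<alpha> =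
     (if Poly_Mapping.lookup \<alpha> m = 0 then 0 else coeff f (\<alpha> - Poly_Mapping.single m 1))"
proof (induction f rule: poly_mapping_add_induct)
  case (single \<beta> c)
  have "Poly_Mapping.single m 1 + \<beta> = \<alpha> \<longleftrightarrow> Poly_Mapping.lookup \<alpha> m \<noteq> 0 \<and> \<beta> = \<alpha> - Poly_Mapping.single m 1"
  proof
    assume "Poly_Mapping.lookup \<alpha> m \<noteq> 0 \<and> \<beta> = \<alpha> - Poly_Mapping.single m 1"
    then show "Poly_Mapping.single m 1 + \<beta> = \<alpha>"
      by (intro poly_mapping_eqI) (auto simp: lookup_add lookup_minus lookup_single when_def)
  qed (auto simp: lookup_add)
  then show ?case
    by (simp add: var_def mult_single lookup_single when_def)
qed (simp add: distrib_left lookup_add)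

lemma coeff_var_mult_add: "coeff (var m * f) (\<alpha> + Poly_Mapping.single m 1) = coeff f \<alpha>"
  by (simp add: coeff_var_mult lookup_add)

lemma coeff_var_power_mult_add: "coeff (var m ^ k * f) (\<alpha> + Poly_Mapping.single m k) = coeff f \<alpha>"
proof (induction k)
  case (Suc k)
  have "\<alpha> + Poly_Mapping.single m (Suc k) = (\<alpha> + Poly_Mapping.single m k) + Poly_Mapping.single m 1"
    by (simp add: single_add[symmetric] add.assoc)
  then show ?case
    using Suc by (simp add: mult.assoc coeff_var_mult_add del: One_nat_def)
qed simp

lemma weight_superset:
  "finite A \<Longrightarrow> Poly_Mapping.keys \<alpha> \<subseteq> A \<Longrightarrow> weight \<alpha> = (\<Sum>i\<in>A. Poly_Mapping.lookup \<alpha> i)"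
  unfolding weight_def by (rule sum.mono_neutral_left) (auto simp: in_keys_iff)

lemma weight_add: "weight (\<alpha> + \<beta>) = weight \<alpha> + weight \<beta>"
proof -
  let ?A = "Poly_Mapping.keys \<alpha> \<union> Poly_Mapping.keys \<beta>"
  have "weight (\<alpha> + \<beta>) = (\<Sum>i\<in>?A. Poly_Mapping.lookup (\<alpha> + \<beta>) i)"
    using keys_add[of \<alpha> \<beta>] by (intro weight_superset) auto
  then show ?thesis
    using weight_superset[of ?A \<alpha>] weight_superset[of ?A \<beta>] by (simp add: lookup_add sum.distrib)
qed

lemma weight_0 [simp]: "weight 0 = 0" and weight_single [simp]: "weight (Poly_Mapping.single i k) = k"
  by (auto simp: weight_def)

text \<open>Used with d the number of inversions of the word. Signs then depend on the degree alone,
  so contributions to the same monomial never cancel.\<close>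

definition sign_related :: "nat \<Rightarrow> mpoly \<Rightarrow> mpoly \<Rightarrow> bool" where
  "sign_related d f g \<longleftrightarrow> (\<forall>\<alpha>. coeff f \<alpha> = (- 1) ^ (d + weight \<alpha>) * coeff g \<alpha>)"

lemma sign_related_add:
  "sign_related d f g \<Longrightarrow> sign_related d f' g' \<Longrightarrow> sign_related d (f + f') (g + g')"
  by (simp add: sign_related_def lookup_add algebra_simps)

lemma sign_related_minus: "sign_related d f g \<Longrightarrow> sign_related (Suc d) (- f) g"
  by (simp add: sign_related_def)

lemma sign_related_var_mult:
  assumes "sign_related d f g"
  shows "sign_related (Suc d) (var m * f) (var m * g)"
  unfolding sign_related_def
proof
  fix \<alpha>
  show "coeff (var m * f) \<alpha> = (- 1) ^ (Suc d + weight \<alpha>) * coeff (var m * g) \<alpha>"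
  proof (cases "Poly_Mapping.lookup \<alpha> m = 0")
    case False
    define \<beta> where "\<beta> = \<alpha> - Poly_Mapping.single m 1"
    have \<alpha>: "\<alpha> = \<beta> + Poly_Mapping.single m 1"
      using False by (intro poly_mapping_eqI) (auto simp: \<beta>_def lookup_add lookup_minus lookup_single when_def)
    show ?thesis
      using assms unfolding \<alpha> coeff_var_mult_add by (simp add: sign_related_def weight_add)
  qed (simp add: coeff_var_mult)
qed

lemma sign_related_Suc_Suc: "sign_related (Suc (Suc d)) f g \<longleftrightarrow> sign_related d f g"
  by (simp add: sign_related_def)

primrec inv_count :: "nat list \<Rightarrow> nat" where
  "inv_count [] = 0"
| "inv_count (c # q) = inv_count q + length (filter (\<lambda>d. d < c) q)"

lemma inv_count_swap: "b < a \<Longrightarrow> inv_count (p @ a # b # q) = Suc (inv_count (p @ b # a # q))"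
  by (induction p) auto

text \<open>An exchange lowers \<open>inv_count\<close> by one while its factor x_m raises the
  degree by one, which preserves the sign. In the term without exchange only the degree rises, and b
  = -1 compensates.\<close>

lemma sign_related_hecke_row:
  assumes "\<And>y. mset y = mset z \<Longrightarrow> sign_related (inv_count y) (F y) (G y)"
  shows "sign_related (inv_count z) (hecke_row (- 1) (var m) i r F z) (hecke_row 1 (var m) i r G z)"
  using assms
proof (induction r arbitrary: z)
  case (Suc r)
  let ?F = "hecke_row (- 1) (var m) i r F" and ?G = "hecke_row 1 (var m) i r G"
  have z: "sign_related (inv_count z) (?F z) (?G z)" using Suc by blast
  show ?case
  proof (cases "adj_descent (i + r) z")
    case True
    let ?y = "swap_adj (i + r) z"
    have "sign_related (inv_count ?y) (?F ?y) (?G ?y)"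
      using True Suc by (intro Suc.IH) (simp add: adj_descent_def mset_swap_adj)
    moreover have inv: "inv_count z = Suc (inv_count ?y)"
      using True by (elim adj_descentE) (simp add: swap_adj_append inv_count_swap)
    ultimately have "sign_related (inv_count z) (var m * ?F ?y) (var m * ?G ?y)"
      by (simp add: sign_related_var_mult)
    moreover have "sign_related (inv_count z) (var m * - ?F z) (var m * ?G z)"
      using sign_related_var_mult[OF sign_related_minus[OF z]] by (simp add: sign_related_Suc_Suc)
    ultimately have "sign_related (inv_count z) (?F z + (var m * ?F ?y + var m * - ?F z))
        (?G z + (var m * ?G ?y + var m * ?G z))"
      using z by (intro sign_related_add)
    then show ?thesis
      using True by (simp add: hecke_step_def hecke_gen_def algebra_simps)
  qed (use z in \<open>simp add: hecke_step_def hecke_gen_def\<close>)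
qed simp

lemma sign_related_word_poly: "sign_related (inv_count z) (word_poly (- 1) z) (word_poly 1 z)"
proof (induction "length z" arbitrary: z)
  case 0
  then show ?case by (simp add: sign_related_def lookup_one when_def)
next
  case (Suc n)
  then have z: "z \<noteq> []" by auto
  show ?case
    unfolding word_poly_rec[OF z refl]
  proof (rule sign_related_hecke_row)
    fix y assume y: "mset y = mset z"
    let ?m = "Min (set z)"
    have sy: "set y = set z" "length y = Suc n" using y Suc.hyps(2) by (metis set_mset_mset, metis size_mset)
    then obtain c t where ct: "y = c # t" by (cases y) auto
    have "inv_count y = inv_count t" if "c = ?m"
    proof -
      have "\<not> d < c" if "d \<in> set t" for d
        using sy ct \<open>c = ?m\<close> that by (metis List.finite_set Min_le linorder_not_less list.set_intros(2))
      then show ?thesis by (simp add: ct)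
    qed
    then show "sign_related (inv_count y) (if hd y = ?m then word_poly (- 1) (tl y) else 0)
        (if hd y = ?m then word_poly 1 (tl y) else 0)"
      using Suc.hyps(1)[of t] sy ct by (auto simp: sign_related_def)
  qed
qed

section \<open>Nonnegative coefficients and multiplicity-freeness\<close>

definition coeffs_nonneg :: "mpoly \<Rightarrow> bool" where
  "coeffs_nonneg f \<longleftrightarrow> (\<forall>\<alpha>. 0 \<le> coeff f \<alpha>)"

lemma coeffs_nonneg_hecke_row:
  assumes "\<And>y. coeffs_nonneg (F y)"
  shows "coeffs_nonneg (hecke_row 1 (var m) i r F z)"
  using assms
  by (induction r arbitrary: z)
    (auto simp: coeffs_nonneg_def hecke_step_def hecke_gen_def lookup_add coeff_var_mult)

lemma coeffs_nonneg_word_poly: "coeffs_nonneg (word_poly 1 z)"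
proof -
  have "coeffs_nonneg (word_poly_aux 1 n z)" for n
  proof (induction n arbitrary: z)
    case (Suc n)
    then have "coeffs_nonneg (if hd y = Min (set z) then word_poly_aux 1 n (tl y) else 0)" for y
      by (simp add: coeffs_nonneg_def)
    then show ?case by (simp add: coeffs_nonneg_hecke_row)
  qed (simp add: coeffs_nonneg_def lookup_one when_def)
  then show ?thesis by (simp add: word_poly_def)
qed

definition multiplicity_free :: "nat list \<Rightarrow> bool" where
  "multiplicity_free z \<longleftrightarrow> (\<forall>\<alpha>. coeff (word_poly 1 z) \<alpha> \<le> 1)"

lemma zero_one_imp_multiplicity_free:
  assumes "zero_one (word_poly (- 1) z)"
  shows "multiplicity_free z"
  unfolding multiplicity_free_def
proof
  fix \<alpha>
  have "\<bar>coeff (word_poly (- 1) z) \<alpha>\<bar> = \<bar>coeff (word_poly 1 z) \<alpha>\<bar>"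
    using sign_related_word_poly[of z] by (simp add: sign_related_def abs_mult power_abs)
  moreover have "\<bar>coeff (word_poly (- 1) z) \<alpha>\<bar> \<le> 1"
    using assms by (auto simp: zero_one_def dest!: spec[where x = \<alpha>])
  ultimately show "coeff (word_poly 1 z) \<alpha> \<le> 1" by linarith
qed

lemma coeff_hecke_row_mono:
  assumes "\<And>y. coeffs_nonneg (F y)" "s \<le> r"
  shows "coeff (hecke_row 1 (var m) i s F z) \<alpha> \<le> coeff (hecke_row 1 (var m) i r F z) \<alpha>"
  using assms(2)
proof (induction r)
  case (Suc r)
  have "0 \<le> coeff (hecke_row 1 (var m) i r F y) \<beta>" for y \<beta>
    using coeffs_nonneg_hecke_row[of F, OF assms(1)] by (simp add: coeffs_nonneg_def)
  then have "coeff (hecke_row 1 (var m) i r F z) \<alpha> \<le> coeff (hecke_row 1 (var m) i (Suc r) F z) \<alpha>"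
    by (simp add: hecke_step_def hecke_gen_def lookup_add coeff_var_mult)
  then show ?case using Suc by (cases "s = Suc r") auto
qed simp

text \<open>Taking the term with x_m in the factor at one descent and the identity in all other
  factors gives F at the sorted word plus F at z, with one further power of x_m. Different descents
  are different choices, so two of them count F at z twice.\<close>

lemma coeff_hecke_row_descent:
  assumes F: "\<And>y. coeffs_nonneg (F y)" and k: "adj_descent k z" "k < r"
  shows "coeff (F (swap_adj k z)) \<alpha> + coeff (F z) \<alpha>
    \<le> coeff (hecke_row 1 (var m) 0 r F z) (\<alpha> + Poly_Mapping.single m 1)"
    and "k' < k \<Longrightarrow> adj_descent k' z \<Longrightarrow>
      2 * coeff (F z) \<alpha> \<le> coeff (hecke_row 1 (var m) 0 r F z) (\<alpha> + Poly_Mapping.single m 1)"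
proof -
  let ?h = "\<lambda>r. hecke_row 1 (var m) 0 r F" and ?e = "Poly_Mapping.single m 1"
  have nn: "0 \<le> coeff (?h r y) \<beta>" for r y \<beta>
    using coeffs_nonneg_hecke_row[of F, OF F] by (simp add: coeffs_nonneg_def)
  have ge: "coeff (F y) \<beta> \<le> coeff (?h r y) \<beta>" for r y \<beta>
    using coeff_hecke_row_mono[of F 0 r, OF F] by simp
  have step: "coeff (?h j z) (\<alpha> + ?e) + coeff (F (swap_adj j z)) \<alpha> + coeff (F z) \<alpha> \<le> coeff (?h r z) (\<alpha> + ?e)"
    if "adj_descent j z" "j < r" for j r
  proof -
    have "coeff (?h (Suc j) z) (\<alpha> + ?e)
        = coeff (?h j z) (\<alpha> + ?e) + (coeff (?h j (swap_adj j z)) \<alpha> + coeff (?h j z) \<alpha>)"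
      using that(1) by (simp add: hecke_step_def hecke_gen_def lookup_add coeff_var_mult_add[simplified])
    moreover have "coeff (?h (Suc j) z) (\<alpha> + ?e) \<le> coeff (?h r z) (\<alpha> + ?e)"
      using that(2) by (intro coeff_hecke_row_mono F) simp
    ultimately show ?thesis
      using ge[of z \<alpha> j] ge[of "swap_adj j z" \<alpha> j] by linarith
  qed
  show "coeff (F (swap_adj k z)) \<alpha> + coeff (F z) \<alpha> \<le> coeff (?h r z) (\<alpha> + ?e)"
    using step[OF k] nn[of k z "\<alpha> + ?e"] by linarith
  assume k': "k' < k" "adj_descent k' z"
  have nF: "0 \<le> coeff (F y) \<beta>" for y \<beta>
    using F by (simp add: coeffs_nonneg_def)
  show "2 * coeff (F z) \<alpha> \<le> coeff (?h r z) (\<alpha> + ?e)"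
    using step[OF k] step[OF k'(2,1)] nn[of k' z "\<alpha> + ?e"] nF[of "swap_adj k z" \<alpha>] nF[of "swap_adj k' z" \<alpha>]
    by linarith
qed

section \<open>Monomials that occur\<close>

text \<open>The exponent vector of the bottom pipe dream, which is the Lehmer code.\<close>

primrec code :: "nat list \<Rightarrow> expvec" where
  "code [] = 0"
| "code (c # q) = code q + (\<Sum>d\<leftarrow>filter (\<lambda>d. d < c) q. Poly_Mapping.single d 1)"

lemma code_append_min:
  assumes "\<forall>y\<in>set xs \<union> set ys. m < y"
  shows "code (xs @ m # ys) = code (xs @ ys) + Poly_Mapping.single m (length xs)"
  using assms
proof (induction xs)
  case Nil
  then have "filter (\<lambda>d. d < m) ys = []" by (auto simp: filter_empty_conv)
  then show ?case by simp
next
  case (Cons c xs)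
  then have "Poly_Mapping.single m (Suc (length xs)) = Poly_Mapping.single m 1 + Poly_Mapping.single m (length xs)"
    by (simp add: single_add[symmetric])
  then show ?case using Cons by (simp add: add_ac)
qed

lemma code_swap: "b < a \<Longrightarrow> code (p @ a # b # q) = code (p @ b # a # q) + Poly_Mapping.single b 1"
  by (induction p) (auto simp: add_ac)

text \<open>Taking the identity in every factor that acts on \<open>ys\<close> leaves only the power
  of x_m.\<close>

lemma coeff_word_poly_remove_min:
  assumes "\<forall>y\<in>set xs \<union> set ys. m < y"
  shows "coeff (word_poly 1 (xs @ ys)) \<alpha>
    \<le> coeff (word_poly 1 (xs @ m # ys)) (\<alpha> + Poly_Mapping.single m (length xs))"
  unfolding word_poly_append[OF assms] coeff_var_power_mult_add
  using coeff_hecke_row_mono[of "\<lambda>ys. word_poly 1 (xs @ ys)" 0 "length ys - 1" m 0 ys \<alpha>]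
  by (simp add: coeffs_nonneg_word_poly)

text \<open>The source of conflicts: both polynomials enter with the same power of x_m, so a
  monomial common to them would get a coefficient of at least 2.\<close>

lemma coeff_word_poly_min_descent:
  assumes "\<forall>y\<in>set xs \<union> set A \<union> set B \<union> {l, i}. m < y" "i < l"
  shows "coeff (word_poly 1 (xs @ A @ i # l # B)) \<alpha> + coeff (word_poly 1 (xs @ A @ l # i # B)) \<alpha>
    \<le> coeff (word_poly 1 (xs @ m # A @ l # i # B)) (\<alpha> + Poly_Mapping.single m (Suc (length xs)))"
proof -
  let ?ys = "A @ l # i # B"
  have m: "\<forall>y\<in>set xs \<union> set ?ys. m < y" using assms(1) by auto
  have "\<alpha> + Poly_Mapping.single m (Suc (length xs))
      = (\<alpha> + Poly_Mapping.single m 1) + Poly_Mapping.single m (length xs)"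
    by (simp add: single_add[symmetric] add.assoc)
  then show ?thesis
    unfolding word_poly_append[OF m]
    using coeff_hecke_row_descent(1)[of "\<lambda>ys. word_poly 1 (xs @ ys)" "length A" ?ys "length ?ys - 1" \<alpha> m]
      assms(2)
    by (simp add: coeff_var_power_mult_add coeffs_nonneg_word_poly swap_adj_append adj_descent_append)
qed

lemma split_min:
  fixes z :: "nat list"
  assumes "distinct z" "z \<noteq> []"
  obtains xs m ys where "z = xs @ m # ys" "\<forall>y\<in>set xs \<union> set ys. m < y"
proof -
  have "Min (set z) \<in> set z" using assms by simp
  then obtain xs ys where z: "z = xs @ Min (set z) # ys" by (meson split_list)
  have "Min (set z) < y" if "y \<in> set xs \<union> set ys" for y
  proof -
    have "y \<in> set z" "y \<noteq> Min (set z)" using that assms(1) z by (metis Un_iff set_append list.set_intros(2), metis Un_iff distinct.simps(2) distinct_append disjoint_iff list.set_intros(1))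
    then show ?thesis by (simp add: le_neq_trans)
  qed
  then show ?thesis using that z by blast
qed

text \<open>Every letter of \<open>xs\<close> exceeds m, so inserting m changes the code by exactly
  the power of x_m that splits off from the polynomial.\<close>

lemma coeff_code: "distinct z \<Longrightarrow> 1 \<le> coeff (word_poly 1 z) (code z)"
proof (induction "length z" arbitrary: z)
  case (Suc n)
  then obtain xs m ys where z: "z = xs @ m # ys" "\<forall>y\<in>set xs \<union> set ys. m < y"
    by (metis split_min length_0_conv nat.distinct(1))
  then have "1 \<le> coeff (word_poly 1 (xs @ ys)) (code (xs @ ys))"
    using Suc by simp
  then show ?case
    using coeff_word_poly_remove_min[OF z(2), of "code (xs @ ys)"] code_append_min[OF z(2)] z by simp
qed (simp add: lookup_one)

lemma before_sorted: "before x y z \<Longrightarrow> sorted z \<Longrightarrow> x \<le> y"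
  by (induction z) auto

lemma not_sorted_split:
  fixes z :: "nat list"
  assumes "\<not> sorted z"
  obtains A l i B where "z = A @ l # i # B" "i < l"
  using assms no_adj_descent_sorted adj_descentE by metis

text \<open>Locates the smallest letter m relative to a marked letter i in the inductions below:
  either i is m and the two splittings coincide, or m lies in p or q and can be deleted while i
  stays.\<close>

lemma min_of_split:
  assumes "p @ i # q = xs @ m # ys" "\<forall>y\<in>set xs \<union> set ys. m < y" "distinct (p @ i # q)"
  shows "i = m \<Longrightarrow> xs = p \<and> ys = q"
    and "i \<noteq> m \<Longrightarrow> m < i \<and> m \<in> set p \<union> set q"
    and "y \<in> set (p @ i # q) \<Longrightarrow> y \<noteq> m \<Longrightarrow> m < y"
proof -
  have eq: "set (p @ i # q) = set (xs @ m # ys)" using assms(1) by simp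
  show *: "m < y" if "y \<in> set (p @ i # q)" "y \<noteq> m" for y
    using that assms(2) unfolding eq by auto
  have "m \<in> set (p @ i # q)" unfolding eq by simp
  then show "i \<noteq> m \<Longrightarrow> m < i \<and> m \<in> set p \<union> set q"
    using *[of i] by auto
  assume i: "i = m"
  then have "m \<notin> set p" "m \<notin> set q" using assms(3) by auto
  then show "xs = p \<and> ys = q"
    using assms(1) i append_Cons_eq_iff[of m p q xs ys] by metis
qed

text \<open>
  In terms of pipe dreams: if some box of the diagram lies to the south-east of the dot in row \<open>i\<close>,
  then a crossing can be added in row \<open>i\<close> to the bottom pipe dream.
\<close>

lemma coeff_code_add:
  "distinct (p @ i # q) \<Longrightarrow> before l j q \<Longrightarrow> i < j \<Longrightarrow> j < l \<Longrightarrow>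
     1 \<le> coeff (word_poly 1 (p @ i # q)) (code (p @ i # q) + Poly_Mapping.single i 1)"
proof (induction "length (p @ i # q)" arbitrary: p q)
  case (Suc n)
  obtain xs m ys where z: "p @ i # q = xs @ m # ys" "\<forall>y\<in>set xs \<union> set ys. m < y"
    using split_min[OF Suc.prems(1)] by auto
  note split = min_of_split[OF z Suc.prems(1)]
  have s3: "\<forall>y\<in>set (p @ i # q). y = m \<or> m < y" using split(3) by blast
  have lj: "l \<in> set q" "j \<in> set q" using before_set[OF Suc.prems(2)] by auto
  have reduce: "1 \<le> coeff (word_poly 1 (u @ m # v)) (code (u @ m # v) + Poly_Mapping.single i 1)"
    if "1 \<le> coeff (word_poly 1 (u @ v)) (code (u @ v) + Poly_Mapping.single i 1)"
      "\<forall>y\<in>set u \<union> set v. m < y" for u v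
    using coeff_word_poly_remove_min[OF that(2), of "code (u @ v) + Poly_Mapping.single i 1"] that(1)
    by (simp add: code_append_min[OF that(2)] add_ac)
  show ?case
  proof (cases "i = m")
    case True
    then have m: "\<forall>y\<in>set p \<union> set q. i < y" using split(1) z(2) by auto
    \<comment> \<open>The letters l and j need not be adjacent; any adjacent descent of q lets the
      row of i contribute one further x_i.\<close>
    have "\<not> sorted q" using before_sorted[OF Suc.prems(2)] Suc.prems(4) by auto
    then obtain A l' i' B where q: "q = A @ l' # i' # B" "i' < l'" by (rule not_sorted_split)
    have "1 \<le> coeff (word_poly 1 (p @ q)) (code (p @ q))"
      using Suc.prems(1) by (intro coeff_code) simp
    moreover have "0 \<le> coeff (word_poly 1 (p @ A @ i' # l' # B)) (code (p @ q))"
      using coeffs_nonneg_word_poly by (simp add: coeffs_nonneg_def)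
    moreover have "\<forall>y\<in>set p \<union> set A \<union> set B \<union> {l', i'}. i < y" using m q(1) by auto
    moreover have "code (p @ i # q) + Poly_Mapping.single i 1 = code (p @ q) + Poly_Mapping.single i (Suc (length p))"
      unfolding code_append_min[OF m] by (simp add: single_add[symmetric] add.assoc)
    ultimately show ?thesis
      using coeff_word_poly_min_descent[of p A B l' i' i "code (p @ q)"] q by simp
  next
    case False
    then consider p1 p2 where "p = p1 @ m # p2" | q1 q2 where "q = q1 @ m # q2"
      using split(2) by (meson UnE split_list)
    then show ?thesis
    proof cases
      case 1
      have "1 \<le> coeff (word_poly 1 ((p1 @ p2) @ i # q)) (code ((p1 @ p2) @ i # q) + Poly_Mapping.single i 1)"
        using Suc.prems Suc.hyps(2) by (intro Suc.hyps(1)) (auto simp: 1)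
      moreover have "\<forall>y\<in>set p1 \<union> set (p2 @ i # q). m < y"
        using s3 Suc.prems(1) unfolding 1 by auto
      ultimately show ?thesis using reduce[of p1 "p2 @ i # q"] by (simp add: 1)
    next
      case 2
      \<comment> \<open>As m < i < j < l, deleting m removes neither l nor j.\<close>
      have "before l j (q1 @ q2)"
        using Suc.prems split(2)[OF False] by (auto simp: 2 before_append)
      then have "1 \<le> coeff (word_poly 1 (p @ i # q1 @ q2)) (code (p @ i # q1 @ q2) + Poly_Mapping.single i 1)"
        using Suc.prems Suc.hyps(2) by (intro Suc.hyps(1)) (auto simp: 2)
      moreover have "\<forall>y\<in>set (p @ i # q1) \<union> set q2. m < y"
        using s3 Suc.prems(1) unfolding 2 by auto
      ultimately show ?thesis using reduce[of "p @ i # q1" q2] by (simp add: 2)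
    qed
  qed
qed simp

text \<open>A ladder move of the last crossing in row \<open>d\<close> up to row \<open>q\<close>.\<close>

lemma coeff_code_move:
  "distinct (p @ q # r @ c # d # s) \<Longrightarrow> q < d \<Longrightarrow> d < c \<Longrightarrow>
     1 \<le> coeff (word_poly 1 (p @ q # r @ c # d # s)) (code (p @ q # r @ d # c # s) + Poly_Mapping.single q 1)"
proof (induction "length (p @ q # r @ c # d # s)" arbitrary: p r s)
  case (Suc n)
  let ?e = "Poly_Mapping.single q 1"
  obtain xs m ys where z: "p @ q # r @ c # d # s = xs @ m # ys" "\<forall>y\<in>set xs \<union> set ys. m < y"
    using split_min[OF Suc.prems(1)] by auto
  note split = min_of_split[OF z Suc.prems(1)]
  have s3: "\<forall>y\<in>set (p @ q # r @ c # d # s). y = m \<or> m < y" using split(3) by blast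
  have reduce: "1 \<le> coeff (word_poly 1 (u @ m # v)) (code (u' @ m # v') + ?e)"
    if "1 \<le> coeff (word_poly 1 (u @ v)) (code (u' @ v') + ?e)"
      "\<forall>y\<in>set u \<union> set v. m < y" "\<forall>y\<in>set u' \<union> set v'. m < y" "length u = length u'" for u v u' v'
    using coeff_word_poly_remove_min[OF that(2), of "code (u' @ v') + ?e"] that(1,4)
    by (simp add: code_append_min[OF that(3)] add_ac)
  show ?case
  proof (cases "q = m")
    case True
    then have m: "\<forall>y\<in>set p \<union> set (r @ c # d # s). q < y" using split(1) z(2) by auto
    have m': "\<forall>y\<in>set p \<union> set (r @ d # c # s). q < y" using m by auto
    \<comment> \<open>The row of q sorts the descent c d at the cost of one x_q, and the code of the
      sorted word is available for what remains.\<close>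
    have "1 \<le> coeff (word_poly 1 (p @ r @ d # c # s)) (code (p @ r @ d # c # s))"
      using Suc.prems(1) by (intro coeff_code) auto
    moreover have "0 \<le> coeff (word_poly 1 (p @ r @ c # d # s)) (code (p @ r @ d # c # s))"
      using coeffs_nonneg_word_poly by (simp add: coeffs_nonneg_def)
    moreover have "\<forall>y\<in>set p \<union> set r \<union> set s \<union> {c, d}. q < y" using m by auto
    moreover have "code (p @ q # r @ d # c # s) + ?e = code (p @ r @ d # c # s) + Poly_Mapping.single q (Suc (length p))"
      unfolding code_append_min[OF m'] by (simp add: single_add[symmetric] add.assoc)
    ultimately show ?thesis
      using coeff_word_poly_min_descent[of p r s c d q "code (p @ r @ d # c # s)"] Suc.prems(3) by simp
  next
    case False
    then have "m \<in> set p \<union> set r \<union> set s" using split(2) Suc.prems by auto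
    then consider p1 p2 where "p = p1 @ m # p2" | r1 r2 where "r = r1 @ m # r2" | s1 s2 where "s = s1 @ m # s2"
      by (meson UnE split_list)
    then show ?thesis
    proof cases
      case 1
      have "1 \<le> coeff (word_poly 1 ((p1 @ p2) @ q # r @ c # d # s)) (code ((p1 @ p2) @ q # r @ d # c # s) + ?e)"
        using Suc.prems Suc.hyps(2) by (intro Suc.hyps(1)) (auto simp: 1)
      moreover have "\<forall>y\<in>set p1 \<union> set (p2 @ q # r @ c # d # s). m < y"
        using s3 Suc.prems(1) unfolding 1 by auto
      moreover from this have "\<forall>y\<in>set p1 \<union> set (p2 @ q # r @ d # c # s). m < y" by auto
      ultimately show ?thesis
        using reduce[of p1 "p2 @ q # r @ c # d # s" p1 "p2 @ q # r @ d # c # s"] by (simp add: 1)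
    next
      case 2
      have "1 \<le> coeff (word_poly 1 (p @ q # (r1 @ r2) @ c # d # s)) (code (p @ q # (r1 @ r2) @ d # c # s) + ?e)"
        using Suc.prems Suc.hyps(2) by (intro Suc.hyps(1)) (auto simp: 2)
      moreover have "\<forall>y\<in>set (p @ q # r1) \<union> set (r2 @ c # d # s). m < y"
        using s3 Suc.prems(1) unfolding 2 by auto
      moreover from this have "\<forall>y\<in>set (p @ q # r1) \<union> set (r2 @ d # c # s). m < y" by auto
      ultimately show ?thesis
        using reduce[of "p @ q # r1" "r2 @ c # d # s" "p @ q # r1" "r2 @ d # c # s"] by (simp add: 2)
    next
      case 3
      have "1 \<le> coeff (word_poly 1 (p @ q # r @ c # d # s1 @ s2)) (code (p @ q # r @ d # c # s1 @ s2) + ?e)"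
        using Suc.prems Suc.hyps(2) by (intro Suc.hyps(1)) (auto simp: 3)
      moreover have "\<forall>y\<in>set (p @ q # r @ c # d # s1) \<union> set s2. m < y"
        using s3 Suc.prems(1) unfolding 3 by auto
      moreover from this have "\<forall>y\<in>set (p @ q # r @ d # c # s1) \<union> set s2. m < y" by auto
      ultimately show ?thesis
        using reduce[of "p @ q # r @ c # d # s1" s2 "p @ q # r @ d # c # s1" s2] by (simp add: 3)
    qed
  qed
qed simp

section \<open>Consequences of multiplicity-freeness\<close>

lemma multiplicity_free_remove_min:
  assumes "multiplicity_free (xs @ m # ys)" "\<forall>y\<in>set xs \<union> set ys. m < y"
  shows "multiplicity_free (xs @ ys)"
  using assms(1) coeff_word_poly_remove_min[OF assms(2)] order_trans
  unfolding multiplicity_free_def by blast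

text \<open>Two descents would produce the Lehmer code of \<open>xs @ ys\<close> twice with the same
  power of x_m.\<close>

lemma multiplicity_free_unique_descent:
  assumes "multiplicity_free (xs @ m # ys)" "\<forall>y\<in>set xs \<union> set ys. m < y" "distinct (xs @ m # ys)"
    and "adj_descent k ys" "adj_descent k' ys"
  shows "k = k'"
proof -
  have False if k: "k' < k" "adj_descent k ys" "adj_descent k' ys" for k k'
  proof -
    let ?c = "code (xs @ ys)"
    have "2 * coeff (word_poly 1 (xs @ ys)) ?c
        \<le> coeff (word_poly 1 (xs @ m # ys)) ((?c + Poly_Mapping.single m 1) + Poly_Mapping.single m (length xs))"
      unfolding word_poly_append[OF assms(2)] coeff_var_power_mult_add
      using k coeff_hecke_row_descent(2)[of "\<lambda>ys. word_poly 1 (xs @ ys)" k ys "length ys - 1" k']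
      by (auto simp: coeffs_nonneg_word_poly adj_descent_def)
    moreover have "1 \<le> coeff (word_poly 1 (xs @ ys)) ?c"
      using assms(3) by (intro coeff_code) simp
    ultimately show False
      using assms(1) unfolding multiplicity_free_def by (smt (verit))
  qed
  then show ?thesis using assms(4,5) by (meson linorder_neqE_nat)
qed

lemma multiplicity_free_disjoint:
  assumes "multiplicity_free (xs @ m # A @ l # i # B)" "\<forall>y\<in>set xs \<union> set (A @ l # i # B). m < y" "i < l"
    and "1 \<le> coeff (word_poly 1 (xs @ A @ l # i # B)) \<alpha>" "1 \<le> coeff (word_poly 1 (xs @ A @ i # l # B)) \<alpha>"
  shows False
proof -
  have "\<forall>y\<in>set xs \<union> set A \<union> set B \<union> {l, i}. m < y" using assms(2) by auto
  from coeff_word_poly_min_descent[OF this assms(3), of \<alpha>] assms(1,4,5) show False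
    unfolding multiplicity_free_def by (smt (verit))
qed

text \<open>The polynomials of the words with l i and with i l share no monomial, and each condition
  excludes a shared one. If B began with a letter between i and l, multiplying the code monomial of
  the sorted word by x_i would give a monomial of that word, and it is the code monomial of the
  unsorted word. If letters q < i < y stood in this order before l, multiplying the same code
  monomial by x_q would give a monomial of the sorted word, and a ladder move would give it for the
  unsorted word.\<close>

lemma multiplicity_free_structure:
  assumes mf: "multiplicity_free (xs @ m # ys)" and m: "\<forall>y\<in>set xs \<union> set ys. m < y"
    and d: "distinct (xs @ m # ys)" and "\<not> sorted ys"
  obtains A l i B where "ys = A @ l # i # B" "i < l" "sorted (A @ [l])" "sorted (l # B)"
    "\<And>p q r. xs @ A = p @ q # r \<Longrightarrow> q < i \<Longrightarrow> \<forall>y\<in>set r. y < i"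
proof -
  obtain A l i B where ys: "ys = A @ l # i # B" and il: "i < l"
    using not_sorted_split[OF assms(4)] .
  have k: "adj_descent (length A) ys" using il by (simp add: ys adj_descent_append)
  have unique: "k = length A" if "adj_descent k ys" for k
    using multiplicity_free_unique_descent[OF mf m d that k] .
  have "\<not> adj_descent k (A @ [l])" for k
    using unique[of k] by (auto simp: adj_descent_def ys nth_append split: if_splits)
  then have Al: "sorted (A @ [l])" by (rule no_adj_descent_sorted)
  have "\<not> adj_descent k (i # B)" for k
    using unique[of "Suc (length A + k)"] by (auto simp: adj_descent_def ys nth_append)
  then have iB: "sorted (i # B)" by (rule no_adj_descent_sorted)
  have dis: False if "1 \<le> coeff (word_poly 1 (xs @ ys)) \<alpha>" "1 \<le> coeff (word_poly 1 (xs @ A @ i # l # B)) \<alpha>" for \<alpha>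
    using multiplicity_free_disjoint[of xs m A l i B \<alpha>] mf m il that by (simp add: ys)
  have c: "code (xs @ ys) = code (xs @ A @ i # l # B) + Poly_Mapping.single i 1"
    using code_swap[OF il, of "xs @ A" B] by (simp add: ys)
  have lB: "sorted (l # B)"
  proof (cases B)
    case (Cons j B')
    have "i \<noteq> j" "i \<le> j" using iB d by (auto simp: ys Cons)
    then have "i < j" by simp
    have "\<not> j < l"
    proof
      assume "j < l"
      \<comment> \<open>In this word i is followed by l and then j, where i < j < l.\<close>
      have "1 \<le> coeff (word_poly 1 ((xs @ A) @ i # l # B))
          (code ((xs @ A) @ i # l # B) + Poly_Mapping.single i 1)"
        by (rule coeff_code_add[of _ _ _ l j]) (use d \<open>j < l\<close> \<open>i < j\<close> in \<open>auto simp: ys Cons\<close>)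
      moreover have "1 \<le> coeff (word_poly 1 (xs @ ys)) (code (xs @ ys))"
        using d by (intro coeff_code) simp
      ultimately show False using dis[of "code (xs @ ys)"] c by simp
    qed
    then show ?thesis using iB Cons by auto
  qed simp
  have "\<forall>y\<in>set r. y < i" if xA: "xs @ A = p @ q # r" and q: "q < i" for p q r
  proof (rule ccontr)
    assume "\<not> (\<forall>y\<in>set r. y < i)"
    then obtain y where y: "y \<in> set r" "i \<le> y" by auto
    have xs: "xs @ A @ v = p @ q # r @ v" for v using xA by (metis append.assoc append_Cons)
    have "distinct (xs @ A @ l # i # B)" using d by (simp add: ys)
    then have dd: "distinct (p @ q # r @ l # i # B)" by (simp only: xs)
    then have "y \<noteq> i" using y(1) by auto
    then have "i < y" using y(2) by simp
    \<comment> \<open>Here q is the row that receives the crossing, and the required pair behind it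
      is y, i with q < i < y.\<close>
    have "1 \<le> coeff (word_poly 1 (p @ q # r @ i # l # B)) (code (p @ q # r @ i # l # B) + Poly_Mapping.single q 1)"
      by (rule coeff_code_add[of _ _ _ y i]) (use dd y q \<open>i < y\<close> in \<open>auto simp: before_append\<close>)
    moreover have "1 \<le> coeff (word_poly 1 (p @ q # r @ l # i # B)) (code (p @ q # r @ i # l # B) + Poly_Mapping.single q 1)"
      by (rule coeff_code_move) (use dd q il in auto)
    ultimately show False using dis by (simp add: ys xs)
  qed
  then show thesis using that ys il Al lB by blast
qed

section \<open>Saturated polynomials\<close>

text \<open>The three assertions of the theorem, in a form that is stable under products.\<close>

definition saturated :: "mpoly \<Rightarrow> bool" where
  "saturated f \<longleftrightarrow> (\<exists>d. (\<exists>\<alpha>\<in>supp f. weight \<alpha> = d)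
     \<and> (\<forall>\<alpha>\<in>supp f. weight \<alpha> = d \<or> weight \<alpha> < d \<and> (\<exists>k. \<alpha> + Poly_Mapping.single k 1 \<in> supp f))
     \<and> (\<forall>\<beta>\<in>supp f. weight \<beta> = d \<longrightarrow> (\<Sum>\<alpha> | \<alpha> \<preceq> \<beta>. coeff f \<alpha>) = 1))"

lemma saturated_1: "saturated 1"
proof -
  have "{\<alpha>. \<alpha> \<preceq> 0} = {0}" by (auto simp: exp_le_def intro: poly_mapping_eqI)
  then show ?thesis by (auto simp: saturated_def)
qed

lemma add_exp_le_add: "\<alpha> + \<gamma> \<preceq> \<beta> + \<gamma> \<longleftrightarrow> \<alpha> \<preceq> \<beta>"
  by (simp add: exp_le_def lookup_add)

lemma supp_var_mult: "\<alpha> \<in> supp (var q * f) \<longleftrightarrow> (\<exists>\<beta>\<in>supp f. \<alpha> = \<beta> + Poly_Mapping.single q 1)"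
proof
  assume "\<alpha> \<in> supp (var q * f)"
  then have q: "Poly_Mapping.lookup \<alpha> q \<noteq> 0" "coeff f (\<alpha> - Poly_Mapping.single q 1) \<noteq> 0"
    by (auto simp: in_keys_iff coeff_var_mult split: if_splits)
  then have "\<alpha> = (\<alpha> - Poly_Mapping.single q 1) + Poly_Mapping.single q 1"
    by (intro poly_mapping_eqI) (auto simp: lookup_add lookup_minus lookup_single when_def)
  then show "\<exists>\<beta>\<in>supp f. \<alpha> = \<beta> + Poly_Mapping.single q 1"
    using q(2) by (metis in_keys_iff)
qed (auto simp: in_keys_iff coeff_var_mult_add[simplified])

text \<open>Not an instance of multiplication in disjoint variables, since q may occur in f.
  Instead, adding one to the exponent of x_q is an order-preserving bijection between the
  supports.\<close>

lemma saturated_var_mult: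
  assumes "saturated f"
  shows "saturated (var q * f)"
proof -
  let ?e = "Poly_Mapping.single q (1::nat)"
  obtain d where top: "\<exists>\<alpha>\<in>supp f. weight \<alpha> = d"
    and up: "\<And>\<alpha>. \<alpha> \<in> supp f \<Longrightarrow> weight \<alpha> = d \<or> weight \<alpha> < d \<and> (\<exists>k. \<alpha> + Poly_Mapping.single k 1 \<in> supp f)"
    and sum: "\<And>\<beta>. \<beta> \<in> supp f \<Longrightarrow> weight \<beta> = d \<Longrightarrow> (\<Sum>\<alpha> | \<alpha> \<preceq> \<beta>. coeff f \<alpha>) = 1"
    using assms unfolding saturated_def by metis
  have "(\<Sum>\<alpha> | \<alpha> \<preceq> \<beta> + ?e. coeff (var q * f) \<alpha>) = (\<Sum>\<alpha> | \<alpha> \<preceq> \<beta>. coeff f \<alpha>)" for \<beta>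
  proof -
    have "(\<Sum>\<alpha> | \<alpha> \<preceq> \<beta> + ?e. coeff (var q * f) \<alpha>) = (\<Sum>\<alpha>\<in>(\<lambda>\<alpha>. \<alpha> + ?e) ` {\<alpha>. \<alpha> \<preceq> \<beta>}. coeff (var q * f) \<alpha>)"
    proof (rule sum.mono_neutral_right)
      show "\<forall>\<alpha>\<in>{\<alpha>. \<alpha> \<preceq> \<beta> + ?e} - (\<lambda>\<alpha>. \<alpha> + ?e) ` {\<alpha>. \<alpha> \<preceq> \<beta>}. coeff (var q * f) \<alpha> = 0"
      proof (rule ballI, rule ccontr)
        fix \<alpha> assume \<alpha>: "\<alpha> \<in> {\<alpha>. \<alpha> \<preceq> \<beta> + ?e} - (\<lambda>\<alpha>. \<alpha> + ?e) ` {\<alpha>. \<alpha> \<preceq> \<beta>}" "coeff (var q * f) \<alpha> \<noteq> 0"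
        then obtain \<gamma> where "\<alpha> = \<gamma> + ?e" using supp_var_mult[of \<alpha> q f] by (auto simp: in_keys_iff)
        then show False using \<alpha>(1) by (auto simp: add_exp_le_add)
      qed
    qed (auto simp: finite_exp_le add_exp_le_add)
    also have "\<dots> = (\<Sum>\<alpha> | \<alpha> \<preceq> \<beta>. coeff f \<alpha>)"
      by (subst sum.reindex) (auto simp: inj_on_def coeff_var_mult_add[simplified])
    finally show ?thesis .
  qed
  then have "\<forall>\<beta>\<in>supp (var q * f). weight \<beta> = Suc d \<longrightarrow> (\<Sum>\<alpha> | \<alpha> \<preceq> \<beta>. coeff (var q * f) \<alpha>) = 1"
    using sum by (auto simp: supp_var_mult weight_add)
  moreover have "\<exists>\<alpha>\<in>supp (var q * f). weight \<alpha> = Suc d"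
    using top by (force simp: supp_var_mult weight_add)
  moreover have "weight \<alpha> = Suc d \<or> weight \<alpha> < Suc d \<and> (\<exists>k. \<alpha> + Poly_Mapping.single k 1 \<in> supp (var q * f))"
    if "\<alpha> \<in> supp (var q * f)" for \<alpha>
  proof -
    obtain \<beta> where \<beta>: "\<beta> \<in> supp f" "\<alpha> = \<beta> + ?e" using \<open>\<alpha> \<in> supp (var q * f)\<close> supp_var_mult by blast
    from up[OF \<beta>(1)] show ?thesis
    proof (elim disjE conjE exE)
      fix k assume "weight \<beta> < d" and k: "\<beta> + Poly_Mapping.single k 1 \<in> supp f"
      then have "\<alpha> + Poly_Mapping.single k 1 = (\<beta> + Poly_Mapping.single k 1) + ?e"
        by (simp add: \<beta> add_ac)
      then have "\<alpha> + Poly_Mapping.single k 1 \<in> supp (var q * f)" using k supp_var_mult by blast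
      then show ?thesis using \<open>weight \<beta> < d\<close> by (auto simp: \<beta> weight_add)
    qed (simp add: \<beta> weight_add)
  qed
  ultimately show ?thesis unfolding saturated_def by blast
qed

lemma saturated_var_power_mult: "saturated f \<Longrightarrow> saturated (var q ^ k * f)"
  by (induction k) (simp_all add: mult.assoc saturated_var_mult)

lemma sum_single_keys: "(\<Sum>k\<in>Poly_Mapping.keys p. Poly_Mapping.single k (Poly_Mapping.lookup p k)) = p"
  by (rule poly_mapping_eqI) (simp add: lookup_sum lookup_single when_def sum.delta in_keys_iff)

lemma disjoint_exp_le:
  fixes \<alpha> \<alpha>' \<gamma> \<gamma>' :: expvec
  assumes "V \<inter> W = {}" "Poly_Mapping.keys \<alpha> \<subseteq> V" "Poly_Mapping.keys \<alpha>' \<subseteq> V"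
    "Poly_Mapping.keys \<gamma> \<subseteq> W" "Poly_Mapping.keys \<gamma>' \<subseteq> W"
  shows "\<alpha>' + \<gamma>' \<preceq> \<alpha> + \<gamma> \<longleftrightarrow> \<alpha>' \<preceq> \<alpha> \<and> \<gamma>' \<preceq> \<gamma>"
proof
  assume le: "\<alpha>' + \<gamma>' \<preceq> \<alpha> + \<gamma>"
  have zero: "k \<in> V \<Longrightarrow> Poly_Mapping.lookup \<gamma> k = 0 \<and> Poly_Mapping.lookup \<gamma>' k = 0"
    "k \<notin> V \<Longrightarrow> Poly_Mapping.lookup \<alpha> k = 0 \<and> Poly_Mapping.lookup \<alpha>' k = 0" for k
    using assms by (metis disjoint_iff in_keys_iff subsetD)+
  have "Poly_Mapping.lookup \<alpha>' k \<le> Poly_Mapping.lookup \<alpha> k \<and> Poly_Mapping.lookup \<gamma>' k \<le> Poly_Mapping.lookup \<gamma> k" for k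
    using le zero[of k] unfolding exp_le_def lookup_add by (metis add.left_neutral add.right_neutral le_refl)
  then show "\<alpha>' \<preceq> \<alpha> \<and> \<gamma>' \<preceq> \<gamma>" by (simp add: exp_le_def)
qed (auto simp: exp_le_def lookup_add intro: add_mono)

lemma disjoint_add_eq:
  fixes \<alpha> \<alpha>' \<gamma> \<gamma>' :: expvec
  assumes "V \<inter> W = {}" "Poly_Mapping.keys \<alpha> \<subseteq> V" "Poly_Mapping.keys \<alpha>' \<subseteq> V"
    "Poly_Mapping.keys \<gamma> \<subseteq> W" "Poly_Mapping.keys \<gamma>' \<subseteq> W" "\<alpha>' + \<gamma>' = \<alpha> + \<gamma>"
  shows "\<alpha>' = \<alpha> \<and> \<gamma>' = \<gamma>"
proof -
  have antisym: "\<delta> = \<epsilon>" if "\<delta> \<preceq> \<epsilon>" "\<epsilon> \<preceq> \<delta>" for \<delta> \<epsilon> :: expvec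
    using that by (intro poly_mapping_eqI) (auto simp: exp_le_def intro: le_antisym)
  have "\<alpha>' + \<gamma>' \<preceq> \<alpha> + \<gamma>" "\<alpha> + \<gamma> \<preceq> \<alpha>' + \<gamma>'" using assms(6) by (simp_all add: exp_le_def)
  then show ?thesis
    using disjoint_exp_le[OF assms(1-5)] disjoint_exp_le[OF assms(1,3,2,5,4)] antisym by blast
qed

lemma coeff_mult_disjoint:
  assumes f: "vars_in V f" and g: "vars_in W g" and VW: "V \<inter> W = {}"
    and "Poly_Mapping.keys \<alpha> \<subseteq> V" "Poly_Mapping.keys \<gamma> \<subseteq> W"
  shows "coeff (f * g) (\<alpha> + \<gamma>) = coeff f \<alpha> * coeff g \<gamma>"
proof -
  have "f * g = (\<Sum>a\<in>supp f. Poly_Mapping.single a (coeff f a)) * (\<Sum>b\<in>supp g. Poly_Mapping.single b (coeff g b))"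
    by (simp only: sum_single_keys)
  also have "\<dots> = (\<Sum>a\<in>supp f. \<Sum>b\<in>supp g. Poly_Mapping.single (a + b) (coeff f a * coeff g b))"
    by (simp add: sum_product mult_single)
  finally have "f * g = (\<Sum>a\<in>supp f. \<Sum>b\<in>supp g. Poly_Mapping.single (a + b) (coeff f a * coeff g b))" .
  then have "coeff (f * g) (\<alpha> + \<gamma>) = (\<Sum>a\<in>supp f. \<Sum>b\<in>supp g. if a + b = \<alpha> + \<gamma> then coeff f a * coeff g b else 0)"
    by (simp add: lookup_sum lookup_single when_def)
  also have "\<dots> = (\<Sum>a\<in>supp f. \<Sum>b\<in>supp g. if a = \<alpha> then if b = \<gamma> then coeff f a * coeff g b else 0 else 0)"
  proof (intro sum.cong refl)
    fix a b assume "a \<in> supp f" "b \<in> supp g"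
    then have "Poly_Mapping.keys a \<subseteq> V" "Poly_Mapping.keys b \<subseteq> W" using f g by (auto simp: vars_in_def)
    then have "a + b = \<alpha> + \<gamma> \<longleftrightarrow> a = \<alpha> \<and> b = \<gamma>"
      using disjoint_add_eq[OF VW assms(4) _ assms(5)] by blast
    then show "(if a + b = \<alpha> + \<gamma> then coeff f a * coeff g b else 0)
        = (if a = \<alpha> then if b = \<gamma> then coeff f a * coeff g b else 0 else 0)" by simp
  qed
  also have "\<dots> = (\<Sum>a\<in>supp f. if a = \<alpha> then coeff f a * coeff g \<gamma> else 0)"
    by (intro sum.cong refl) (auto simp: sum.delta in_keys_iff)
  also have "\<dots> = coeff f \<alpha> * coeff g \<gamma>"
    by (auto simp: sum.delta in_keys_iff)
  finally show ?thesis .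
qed

text \<open>In disjoint variables an exponent vector of the product splits uniquely and its
  coefficient is a product, so nothing cancels and degrees add. Below the top degree one of the two
  parts can be raised. The relevant exponent vectors below \<alpha> + \<gamma> form a product set,
  so the sums of coefficients multiply.\<close>

lemma saturated_mult_disjoint:
  assumes f: "vars_in V f" and g: "vars_in W g" and VW: "V \<inter> W = {}"
    and sat: "saturated f" "saturated g"
  shows "saturated (f * g)"
proof -
  have kf: "Poly_Mapping.keys \<alpha> \<subseteq> V" if "\<alpha> \<in> supp f" for \<alpha> using f that by (auto simp: vars_in_def)
  have kg: "Poly_Mapping.keys \<gamma> \<subseteq> W" if "\<gamma> \<in> supp g" for \<gamma> using g that by (auto simp: vars_in_def)
  have in_fg: "\<alpha> + \<gamma> \<in> supp (f * g)" if "\<alpha> \<in> supp f" "\<gamma> \<in> supp g" for \<alpha> \<gamma>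
    using coeff_mult_disjoint[OF f g VW kf[OF that(1)] kg[OF that(2)]] that by (simp add: in_keys_iff)
  have split: "\<exists>\<alpha>\<in>supp f. \<exists>\<gamma>\<in>supp g. \<delta> = \<alpha> + \<gamma>" if "\<delta> \<in> supp (f * g)" for \<delta>
    using that keys_mult[of f g] by blast
  obtain d where topf: "\<exists>\<alpha>\<in>supp f. weight \<alpha> = d"
    and upf: "\<And>\<alpha>. \<alpha> \<in> supp f \<Longrightarrow> weight \<alpha> = d \<or> weight \<alpha> < d \<and> (\<exists>k. \<alpha> + Poly_Mapping.single k 1 \<in> supp f)"
    and sumf: "\<And>\<beta>. \<beta> \<in> supp f \<Longrightarrow> weight \<beta> = d \<Longrightarrow> (\<Sum>\<alpha> | \<alpha> \<preceq> \<beta>. coeff f \<alpha>) = 1"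
    using sat(1) unfolding saturated_def by metis
  obtain e where topg: "\<exists>\<alpha>\<in>supp g. weight \<alpha> = e"
    and upg: "\<And>\<alpha>. \<alpha> \<in> supp g \<Longrightarrow> weight \<alpha> = e \<or> weight \<alpha> < e \<and> (\<exists>k. \<alpha> + Poly_Mapping.single k 1 \<in> supp g)"
    and sumg: "\<And>\<beta>. \<beta> \<in> supp g \<Longrightarrow> weight \<beta> = e \<Longrightarrow> (\<Sum>\<alpha> | \<alpha> \<preceq> \<beta>. coeff g \<alpha>) = 1"
    using sat(2) unfolding saturated_def by metis
  have "\<exists>\<delta>\<in>supp (f * g). weight \<delta> = d + e"
    using topf topg in_fg by (metis weight_add)
  moreover have "weight \<delta> = d + e \<or> weight \<delta> < d + e \<and> (\<exists>k. \<delta> + Poly_Mapping.single k 1 \<in> supp (f * g))"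
    if in_supp: "\<delta> \<in> supp (f * g)" for \<delta>
  proof -
    obtain \<alpha> \<gamma> where \<delta>: "\<delta> = \<alpha> + \<gamma>" "\<alpha> \<in> supp f" "\<gamma> \<in> supp g" using split in_supp by blast
    consider "weight \<alpha> = d" "weight \<gamma> = e" | "weight \<alpha> < d" "weight \<gamma> \<le> e" | "weight \<alpha> \<le> d" "weight \<gamma> < e"
      using upf[OF \<delta>(2)] upg[OF \<delta>(3)] by fastforce
    then show ?thesis
    proof cases
      case 2
      then obtain k where "\<alpha> + Poly_Mapping.single k 1 \<in> supp f" using upf[OF \<delta>(2)] by auto
      from in_fg[OF this \<delta>(3)] have "\<delta> + Poly_Mapping.single k 1 \<in> supp (f * g)"
        by (simp add: \<delta> add_ac)
      then show ?thesis using 2 by (auto simp: \<delta> weight_add)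
    next
      case 3
      then obtain k where "\<gamma> + Poly_Mapping.single k 1 \<in> supp g" using upg[OF \<delta>(3)] by auto
      from in_fg[OF \<delta>(2) this] have "\<delta> + Poly_Mapping.single k 1 \<in> supp (f * g)"
        by (simp add: \<delta> add_ac)
      then show ?thesis using 3 by (auto simp: \<delta> weight_add)
    qed (simp add: \<delta> weight_add)
  qed
  moreover have "(\<Sum>\<epsilon> | \<epsilon> \<preceq> \<delta>. coeff (f * g) \<epsilon>) = 1" if in_supp: "\<delta> \<in> supp (f * g)" "weight \<delta> = d + e" for \<delta>
  proof -
    obtain \<alpha> \<gamma> where \<delta>: "\<delta> = \<alpha> + \<gamma>" "\<alpha> \<in> supp f" "\<gamma> \<in> supp g" using split in_supp(1) by blast
    have w: "weight \<alpha> = d" "weight \<gamma> = e"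
      using upf[OF \<delta>(2)] upg[OF \<delta>(3)] in_supp(2) by (auto simp: \<delta> weight_add)
    have sub: "Poly_Mapping.keys \<alpha>' \<subseteq> U" if "\<alpha>' \<preceq> \<alpha>" "Poly_Mapping.keys \<alpha> \<subseteq> U" for \<alpha> \<alpha>' :: expvec and U
      using that by (auto simp: exp_le_def in_keys_iff subset_iff) (meson order_less_le_trans)
    let ?S = "{\<alpha>'. \<alpha>' \<preceq> \<alpha>} \<times> {\<gamma>'. \<gamma>' \<preceq> \<gamma>}"
    have keys: "Poly_Mapping.keys \<alpha>' \<subseteq> V" "Poly_Mapping.keys \<gamma>' \<subseteq> W" if "(\<alpha>', \<gamma>') \<in> ?S" for \<alpha>' \<gamma>'
      using that sub kf[OF \<delta>(2)] kg[OF \<delta>(3)] by blast+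
    have inj: "inj_on (\<lambda>(\<alpha>', \<gamma>'). \<alpha>' + \<gamma>') ?S"
    proof (rule inj_onI, clarify)
      fix a b a' b' assume "a \<preceq> \<alpha>" "b \<preceq> \<gamma>" "a' \<preceq> \<alpha>" "b' \<preceq> \<gamma>" and eq: "a + b = a' + b'"
      then show "a = a' \<and> b = b'"
        using disjoint_add_eq[OF VW keys(1) keys(1) keys(2) keys(2) eq, of b' b a' a] by simp
    qed
    have "(\<Sum>\<epsilon> | \<epsilon> \<preceq> \<delta>. coeff (f * g) \<epsilon>) = (\<Sum>\<epsilon>\<in>(\<lambda>(\<alpha>', \<gamma>'). \<alpha>' + \<gamma>') ` ?S. coeff (f * g) \<epsilon>)"
    proof (rule sum.mono_neutral_right)
      show "(\<lambda>(\<alpha>', \<gamma>'). \<alpha>' + \<gamma>') ` ?S \<subseteq> {\<epsilon>. \<epsilon> \<preceq> \<delta>}"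
        by (auto simp: \<delta> exp_le_def lookup_add intro!: add_mono)
      show "\<forall>\<epsilon>\<in>{\<epsilon>. \<epsilon> \<preceq> \<delta>} - (\<lambda>(\<alpha>', \<gamma>'). \<alpha>' + \<gamma>') ` ?S. coeff (f * g) \<epsilon> = 0"
      proof (rule ballI, rule ccontr)
        fix \<epsilon> assume \<epsilon>: "\<epsilon> \<in> {\<epsilon>. \<epsilon> \<preceq> \<delta>} - (\<lambda>(\<alpha>', \<gamma>'). \<alpha>' + \<gamma>') ` ?S" and "coeff (f * g) \<epsilon> \<noteq> 0"
        then obtain a b where ab: "\<epsilon> = a + b" "a \<in> supp f" "b \<in> supp g"
          using split[of \<epsilon>] by (auto simp: in_keys_iff)
        then have "(a, b) \<in> ?S"
          using \<epsilon> disjoint_exp_le[OF VW kf[OF \<delta>(2)] kf[OF ab(2)] kg[OF \<delta>(3)] kg[OF ab(3)]] by (simp add: \<delta>)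
        then have "\<epsilon> \<in> (\<lambda>(\<alpha>', \<gamma>'). \<alpha>' + \<gamma>') ` ?S" unfolding ab(1) by (rule rev_image_eqI) simp
        then show False using \<epsilon> by blast
      qed
    qed (rule finite_exp_le)
    also have "\<dots> = (\<Sum>(\<alpha>', \<gamma>')\<in>?S. coeff f \<alpha>' * coeff g \<gamma>')"
      unfolding sum.reindex[OF inj]
      using coeff_mult_disjoint[OF f g VW keys] by (intro sum.cong) auto
    also have "\<dots> = (\<Sum>\<alpha>' | \<alpha>' \<preceq> \<alpha>. coeff f \<alpha>') * (\<Sum>\<gamma>' | \<gamma>' \<preceq> \<gamma>. coeff g \<gamma>')"
      by (simp add: sum_product sum.cartesian_product)
    finally show ?thesis using sumf[OF \<delta>(2) w(1)] sumg[OF \<delta>(3) w(2)] by simp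
  qed
  ultimately show ?thesis unfolding saturated_def by blast
qed

section \<open>Two families of factors\<close>

text \<open>Expansion gives (-1)^(|T|+1) x^T for every nonempty subset T of S, so x^S is the only
  top monomial and all others lie below it. The sum of all coefficients is the value at x = 1, which
  is 1 since S is nonempty.\<close>

lemma saturated_one_minus_prod:
  assumes S: "finite S" "S \<noteq> {}"
  shows "saturated (1 - (\<Prod>q\<in>S. 1 - var q))"
proof -
  define ind where "ind T = (\<Sum>q\<in>T. Poly_Mapping.single q (1::nat))" for T :: "nat set"
  let ?f = "1 - (\<Prod>q\<in>S. 1 - var q)"
  have lind: "Poly_Mapping.lookup (ind T) k = (if k \<in> T then 1 else 0)" if "T \<subseteq> S" for T k
    using finite_subset[OF that S(1)] by (simp add: ind_def lookup_sum lookup_single when_def)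
  have ind_eq: "ind T = ind T' \<longleftrightarrow> T = T'" if "T \<subseteq> S" "T' \<subseteq> S" for T T'
    using lind[OF that(1)] lind[OF that(2)] by (metis subsetI subset_antisym zero_neq_one)
  have w: "weight (ind T) = card T" if "T \<subseteq> S" for T
    using finite_subset[OF that S(1)] by (induction T) (simp_all add: ind_def weight_add)
  have prod_var: "(\<Prod>q\<in>T. - var q) = Poly_Mapping.single (ind T) ((- 1) ^ card T)" if "finite T" for T
    using that
  proof (induction T)
    case (insert q T)
    have "- var q = Poly_Mapping.single (Poly_Mapping.single q 1) (- 1)"
      by (simp add: var_def single_uminus)
    then show ?case using insert by (simp add: mult_single ind_def)
  qed (simp add: ind_def)
  have "(\<Prod>q\<in>S. 1 - var q) = (\<Prod>q\<in>S. - var q + 1)" by (simp add: algebra_simps)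
  also have "\<dots> = (\<Sum>T\<in>Pow S. (\<Prod>q\<in>T. - var q) * (\<Prod>q\<in>S - T. 1))"
    by (rule prod_add) fact
  also have "\<dots> = (\<Sum>T\<in>Pow S. Poly_Mapping.single (ind T) ((- 1) ^ card T))"
    using S(1) by (intro sum.cong) (auto simp: prod_var finite_subset)
  finally have prod: "(\<Prod>q\<in>S. 1 - var q) = (\<Sum>T\<in>Pow S. Poly_Mapping.single (ind T) ((- 1) ^ card T))" .
  have coeff_prod: "coeff (\<Prod>q\<in>S. 1 - var q) (ind T) = (- 1) ^ card T" if "T \<subseteq> S" for T
  proof -
    have "coeff (\<Prod>q\<in>S. 1 - var q) (ind T) = (\<Sum>T'\<in>Pow S. if T' = T then (- 1) ^ card T' else 0)"
      unfolding prod lookup_sum by (intro sum.cong) (auto simp: lookup_single when_def ind_eq that)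
    then show ?thesis using that S(1) by (simp add: sum.delta)
  qed
  have ind0: "ind {} = 0" by (simp add: ind_def)
  have coeff_f: "coeff ?f (ind T) = (if T = {} then 0 else - ((- 1) ^ card T))" if "T \<subseteq> S" for T
    using coeff_prod[OF that] ind_eq[OF that, of "{}"] ind0
    by (auto simp: lookup_minus lookup_one when_def)
  have supp_f: "\<alpha> \<in> supp ?f \<longleftrightarrow> (\<exists>T. T \<subseteq> S \<and> T \<noteq> {} \<and> \<alpha> = ind T)" for \<alpha>
  proof
    assume "\<alpha> \<in> supp ?f"
    moreover have "coeff ?f \<alpha> = 0" if "\<alpha> \<notin> ind ` Pow S"
    proof -
      have "coeff (\<Prod>q\<in>S. 1 - var q) \<alpha> = 0"
        unfolding prod lookup_sum using that by (intro sum.neutral) (auto simp: lookup_single when_def)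
      moreover have "\<alpha> \<noteq> 0" using that ind0 by (metis Pow_bottom image_eqI)
      ultimately show ?thesis by (simp add: lookup_minus lookup_one when_def)
    qed
    ultimately obtain T where "T \<subseteq> S" "\<alpha> = ind T" by (auto simp: in_keys_iff)
    then show "\<exists>T. T \<subseteq> S \<and> T \<noteq> {} \<and> \<alpha> = ind T"
      using \<open>\<alpha> \<in> supp ?f\<close> coeff_f by (metis in_keys_iff)
  qed (auto simp: in_keys_iff coeff_f split: if_splits)
  have "\<exists>\<alpha>\<in>supp ?f. weight \<alpha> = card S"
  proof
    show "ind S \<in> supp ?f" unfolding supp_f using S(2) by blast
  qed (simp add: w)
  moreover have "weight \<alpha> = card S \<or> weight \<alpha> < card S \<and> (\<exists>k. \<alpha> + Poly_Mapping.single k 1 \<in> supp ?f)"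
    if \<alpha>: "\<alpha> \<in> supp ?f" for \<alpha>
  proof -
    obtain T where T: "T \<subseteq> S" "T \<noteq> {}" "\<alpha> = ind T" using \<alpha> supp_f by blast
    show ?thesis
    proof (cases "T = S")
      case False
      then obtain k where k: "k \<in> S" "k \<notin> T" using T by blast
      have "\<alpha> + Poly_Mapping.single k 1 = ind (insert k T)"
        using k T(3) finite_subset[OF T(1) S(1)] by (simp add: ind_def add.commute)
      moreover have "insert k T \<subseteq> S" "insert k T \<noteq> {}" using k T(1) by auto
      ultimately have "\<alpha> + Poly_Mapping.single k 1 \<in> supp ?f" unfolding supp_f by (intro exI conjI)
      moreover have "weight \<alpha> < card S"
        using T False w S(1) by (metis psubsetI psubset_card_mono)
      ultimately show ?thesis by blast
    qed (simp add: T w)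
  qed
  moreover have "(\<Sum>\<alpha> | \<alpha> \<preceq> \<beta>. coeff ?f \<alpha>) = 1" if \<beta>: "\<beta> \<in> supp ?f" "weight \<beta> = card S" for \<beta>
  proof -
    obtain T where T: "T \<subseteq> S" "\<beta> = ind T" using \<beta> supp_f by blast
    then have "T = S" using \<beta>(2) w S(1) by (metis card_subset_eq)
    then have \<beta>: "\<beta> = ind S" using T by simp
    have "(\<Sum>\<alpha> | \<alpha> \<preceq> \<beta>. coeff ?f \<alpha>) = (\<Sum>\<alpha>\<in>ind ` Pow S. coeff ?f \<alpha>)"
    proof (rule sum.mono_neutral_right)
      show "ind ` Pow S \<subseteq> {\<alpha>. \<alpha> \<preceq> \<beta>}"
        using lind[OF subset_refl] lind by (auto simp: \<beta> exp_le_def)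
      show "\<forall>\<alpha>\<in>{\<alpha>. \<alpha> \<preceq> \<beta>} - ind ` Pow S. coeff ?f \<alpha> = 0"
        using supp_f by (auto simp: in_keys_iff)
    qed (rule finite_exp_le)
    also have "\<dots> = (\<Sum>T\<in>Pow S. coeff ?f (ind T))"
      by (subst sum.reindex) (auto simp: inj_on_def ind_eq)
    also have "\<dots> = (\<Sum>T\<in>Pow S. (if T = {} then 1 else 0) - (- 1) ^ card T)"
      by (intro sum.cong) (auto simp: coeff_f)
    also have "\<dots> = 1 - (\<Sum>T\<in>Pow S. (- 1) ^ card T)"
      using S(1) by (simp add: sum_subtractf sum.delta)
    also have "(\<Sum>T\<in>Pow S. (- 1) ^ card T) = (\<Prod>q\<in>S. (- 1) + (1::int))"
      using prod_add[OF S(1), of "\<lambda>_. - 1" "\<lambda>_. 1::int"] by simp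
    also have "\<dots> = 0" using S by (simp add: card_gt_0_iff)
    finally show ?thesis by simp
  qed
  ultimately show ?thesis unfolding saturated_def by blast
qed

text \<open>\<open>hook_factor x y k\<close> is \<open>h\<^sub>k(x, y) - x y h\<^sub>k\<^sub>-\<^sub>1(x, y)\<close>.\<close>

primrec hook_factor :: "mpoly \<Rightarrow> mpoly \<Rightarrow> nat \<Rightarrow> mpoly" where
  "hook_factor x y 0 = 1"
| "hook_factor x y (Suc k) = (1 - x) * y ^ Suc k + x * hook_factor x y k"

lemma vars_in_hook_factor: "vars_in {m, i} (hook_factor (var m) (var i) k)"
  by (induction k) (auto intro!: vars_in_add vars_in_diff vars_in_mult vars_in_power)

lemma coeff_hook_factor:
  assumes "m \<noteq> i"
  shows "coeff (hook_factor (var m) (var i) k) (Poly_Mapping.single m a + Poly_Mapping.single i b)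
    = (if a + b = k then 1 else if a + b = Suc k \<and> 0 < a \<and> 0 < b then - 1 else 0)"
proof -
  let ?M = "\<lambda>a b. Poly_Mapping.single m a + Poly_Mapping.single i (b::nat)"
  have lM: "Poly_Mapping.lookup (?M a b) m = a" "Poly_Mapping.lookup (?M a b) i = b" for a b
    using assms by (simp_all add: lookup_add lookup_single)
  have x: "coeff (var m * f) (?M a b) = (if a = 0 then 0 else coeff f (?M (a - 1) b))" for f a b
  proof (cases a)
    case (Suc a')
    then have "?M a b = ?M a' b + Poly_Mapping.single m 1" by (simp add: single_add[symmetric] add_ac)
    then show ?thesis using Suc coeff_var_mult_add[of m f "?M a' b"] by simp
  qed (use assms in \<open>simp add: coeff_var_mult lookup_single when_def\<close>)
  have y: "coeff (var i ^ e) (?M a b) = (if a = 0 \<and> b = e then 1 else 0)" for e a b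
  proof -
    have "Poly_Mapping.single i e = ?M a b \<longleftrightarrow> a = 0 \<and> b = e"
    proof
      assume "Poly_Mapping.single i e = ?M a b"
      then have "?M 0 e = ?M a b" by simp
      then show "a = 0 \<and> b = e" using lM by metis
    qed simp
    moreover from this have "?M a b = Poly_Mapping.single i e \<longleftrightarrow> a = 0 \<and> b = e" by (metis (full_types))
    ultimately show ?thesis by (simp add: var_power lookup_single when_def)
  qed
  show ?thesis
  proof (induction k arbitrary: a b)
    case 0
    then show ?case using y[of 0 a b] by auto
  next
    case (Suc k)
    have "hook_factor (var m) (var i) (Suc k)
        = var i ^ Suc k - var m * var i ^ Suc k + var m * hook_factor (var m) (var i) k"
      by (simp add: algebra_simps)
    then show ?case
      by (simp only: lookup_add lookup_minus x y Suc) auto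
  qed
qed

text \<open>Every monomial of degree k in the two variables has coefficient 1, and those of degree k
  + 1 divisible by x_m x_i have coefficient -1. Below one of the latter lie two of the former and
  the monomial itself, and 1 + 1 - 1 = 1. For k = 0 the factor is 1 and has no monomial of degree k
  + 1.\<close>

lemma saturated_hook_factor:
  assumes mi: "m \<noteq> i" and k: "0 < k"
  shows "saturated (hook_factor (var m) (var i) k)"
proof -
  let ?f = "hook_factor (var m) (var i) k"
  let ?M = "\<lambda>a b. Poly_Mapping.single m a + Poly_Mapping.single i (b::nat)"
  have lM: "Poly_Mapping.lookup (?M a b) m = a" "Poly_Mapping.lookup (?M a b) i = b" for a b
    using assms by (simp_all add: lookup_add lookup_single)
  have M_eq: "?M a b = ?M a' b' \<longleftrightarrow> a = a' \<and> b = b'" for a b a' b'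
    using lM by metis
  have w: "weight (?M a b) = a + b" for a b by (simp add: weight_add)
  have step: "?M a b + Poly_Mapping.single m 1 = ?M (Suc a) b" "?M a b + Poly_Mapping.single i 1 = ?M a (Suc b)" for a b
    by (simp_all add: single_add[symmetric] add.assoc) (simp_all add: add_ac single_add[symmetric])
  have supp_f: "\<alpha> \<in> supp ?f \<longleftrightarrow> (\<exists>a b. \<alpha> = ?M a b \<and> (a + b = k \<or> a + b = Suc k \<and> 0 < a \<and> 0 < b))" for \<alpha>
  proof
    assume \<alpha>: "\<alpha> \<in> supp ?f"
    then have "Poly_Mapping.keys \<alpha> \<subseteq> {m, i}" using vars_in_hook_factor by (auto simp: vars_in_def)
    then have "\<alpha> = ?M (Poly_Mapping.lookup \<alpha> m) (Poly_Mapping.lookup \<alpha> i)"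
      using mi by (intro poly_mapping_eqI) (auto simp: lookup_add lookup_single when_def in_keys_iff subset_iff)
    then obtain a b where "\<alpha> = ?M a b" by blast
    then show "\<exists>a b. \<alpha> = ?M a b \<and> (a + b = k \<or> a + b = Suc k \<and> 0 < a \<and> 0 < b)"
      using \<alpha> coeff_hook_factor[OF mi, of k a b] by (auto simp: in_keys_iff split: if_splits)
  qed (auto simp: in_keys_iff coeff_hook_factor[OF mi])
  have "\<exists>\<alpha>\<in>supp ?f. weight \<alpha> = Suc k"
  proof
    show "?M 1 k \<in> supp ?f" unfolding supp_f using k by (intro exI[of _ 1] exI[of _ k]) simp
  qed (simp add: w)
  moreover have "weight \<alpha> = Suc k \<or> weight \<alpha> < Suc k \<and> (\<exists>l. \<alpha> + Poly_Mapping.single l 1 \<in> supp ?f)"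
    if \<alpha>: "\<alpha> \<in> supp ?f" for \<alpha>
  proof -
    obtain a b where ab: "\<alpha> = ?M a b" "a + b = k \<or> a + b = Suc k" using \<alpha> supp_f by blast
    show ?thesis
    proof (cases "a + b = k")
      case True
      have "\<exists>l. \<alpha> + Poly_Mapping.single l 1 \<in> supp ?f"
      \<comment> \<open>For a = 0 only x_m can be added, because x_i^(k+1) has coefficient 0; for
        positive a, adding x_i works.\<close>
      proof (cases a)
        case 0
        have "\<alpha> + Poly_Mapping.single m 1 = ?M (Suc 0) k" using step(1)[of 0 k] 0 True ab(1) by (simp add: add.commute)
        moreover have "?M (Suc 0) k \<in> supp ?f"
          unfolding supp_f using k by (intro exI[of _ "Suc 0"] exI[of _ k]) simp
        ultimately show ?thesis by metis
      next
        case (Suc a')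
        have "\<alpha> + Poly_Mapping.single i 1 = ?M a (Suc b)" using ab(1) step(2) by simp
        moreover have "?M a (Suc b) \<in> supp ?f" unfolding supp_f using True Suc by (intro exI[of _ a] exI[of _ "Suc b"]) simp
        ultimately show ?thesis by metis
      qed
      then show ?thesis using True ab by (simp add: w)
    qed (use ab in \<open>simp add: w\<close>)
  qed
  moreover have "(\<Sum>\<alpha> | \<alpha> \<preceq> \<beta>. coeff ?f \<alpha>) = 1" if \<beta>: "\<beta> \<in> supp ?f" "weight \<beta> = Suc k" for \<beta>
  proof -
    obtain a b where ab: "\<beta> = ?M (Suc a) (Suc b)" "Suc (a + b) = k"
    proof -
      obtain a b where "\<beta> = ?M a b" "a + b = k \<or> a + b = Suc k \<and> 0 < a \<and> 0 < b"
        using \<beta>(1) supp_f by blast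
      moreover from this have "a + b = Suc k" using \<beta>(2) by (auto simp: w)
      ultimately show ?thesis using that[of "a - 1" "b - 1"] by auto
    qed
    have M_le: "?M a' b' \<preceq> ?M a b \<longleftrightarrow> a' \<le> a \<and> b' \<le> b" for a b a' b'
    proof
      assume "?M a' b' \<preceq> ?M a b"
      then show "a' \<le> a \<and> b' \<le> b" unfolding exp_le_def using lM by metis
    qed (simp add: exp_le_def lookup_add lookup_single when_def)
    let ?T = "{?M a (Suc b), ?M (Suc a) b, ?M (Suc a) (Suc b)}"
    have "(\<Sum>\<alpha> | \<alpha> \<preceq> \<beta>. coeff ?f \<alpha>) = (\<Sum>\<alpha>\<in>?T. coeff ?f \<alpha>)"
    proof (rule sum.mono_neutral_right)
      show "?T \<subseteq> {\<alpha>. \<alpha> \<preceq> \<beta>}" unfolding ab(1) by (simp only: insert_subset mem_Collect_eq M_le) simp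
      show "\<forall>\<alpha>\<in>{\<alpha>. \<alpha> \<preceq> \<beta>} - ?T. coeff ?f \<alpha> = 0"
      proof (rule ballI, rule ccontr)
        fix \<alpha> assume \<alpha>: "\<alpha> \<in> {\<alpha>. \<alpha> \<preceq> \<beta>} - ?T" "coeff ?f \<alpha> \<noteq> 0"
        then obtain a' b' where ab': "\<alpha> = ?M a' b'" "a' + b' = k \<or> a' + b' = Suc k"
          using supp_f[of \<alpha>] by (auto simp: in_keys_iff)
        then have "a' \<le> Suc a" "b' \<le> Suc b" using \<alpha>(1) M_le unfolding ab(1) by auto
        then have "a' = a \<and> b' = Suc b \<or> a' = Suc a \<and> b' = b \<or> a' = Suc a \<and> b' = Suc b"
          using ab' ab(2) by auto
        then show False using \<alpha>(1) ab'(1) by blast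
      qed
    qed (rule finite_exp_le)
    also have "\<dots> = coeff ?f (?M a (Suc b)) + (coeff ?f (?M (Suc a) b) + coeff ?f (?M (Suc a) (Suc b)))"
    proof -
      have "?M a (Suc b) \<noteq> ?M (Suc a) b" "?M a (Suc b) \<noteq> ?M (Suc a) (Suc b)" "?M (Suc a) b \<noteq> ?M (Suc a) (Suc b)"
        unfolding M_eq by simp_all
      then show ?thesis by simp
    qed
    also have "\<dots> = 1"
      unfolding coeff_hook_factor[OF mi] using ab(2) by auto
    finally show ?thesis .
  qed
  ultimately show ?thesis unfolding saturated_def by blast
qed

section \<open>Factorization of multiplicity-free Grothendieck polynomials\<close>

lemma adj_descent_append_left: "Suc k < length p \<Longrightarrow> adj_descent k (p @ q) \<longleftrightarrow> adj_descent k p"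
  by (auto simp: adj_descent_def nth_append)

lemma adj_descent_append_right: "length p \<le> k \<Longrightarrow> adj_descent k (p @ q) \<Longrightarrow> adj_descent (k - length p) q"
  by (auto simp: adj_descent_def nth_append Suc_diff_le)

text \<open>Exchanging l and i creates no descent further left, because \<open>A @ [i]\<close> is
  sorted; so every factor other than the one at the descent is trivial.\<close>

lemma hecke_row_one_descent:
  assumes "sorted (A @ [l])" "sorted (A @ [i])" "sorted (i # B)" "i < l"
  shows "hecke_row b x 0 (length (A @ l # i # B) - 1) F (A @ l # i # B)
    = F (A @ l # i # B) + x * (F (A @ i # l # B) + b * F (A @ l # i # B))"
proof -
  have left: "\<not> adj_descent k (A @ c # q)" if "sorted (A @ [c])" "k < length A" for k c q
    using adj_descent_append_left[of k "A @ [c]" q] sorted_no_adj_descent[OF that(1)] that(2) by simp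
  have "\<not> adj_descent k (A @ l # i # B)" if "Suc (length A) \<le> k" for k
    using adj_descent_append_right[of "A @ [l]" k "i # B"] sorted_no_adj_descent[OF assms(3)] that by auto
  then have "hecke_row b x 0 (length (A @ l # i # B) - 1) F (A @ l # i # B)
      = hecke_row b x 0 (Suc (length A)) F (A @ l # i # B)"
    by (intro hecke_row_no_descent) auto
  moreover have "hecke_row b x 0 (length A) F (A @ c # q) = F (A @ c # q)" if "sorted (A @ [c])" for c q
    using hecke_row_no_descent[of 0 0 "length A" "A @ c # q"] left[OF that] by simp
  ultimately show ?thesis
    using assms by (simp add: hecke_step_def hecke_gen_def adj_descent_append swap_adj_append)
qed

text \<open>Here m and i are the two smallest letters, and i is the only letter that moves left in
  the row of m. At each left neighbour the row either exchanges it with i, with weight x_m, and goes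
  on, or leaves i in place, with weight 1 - x_m, and stops because no descent remains. This is the
  recursion of \<open>hook_factor\<close>.\<close>

lemma word_poly_second_min:
  assumes "\<forall>y\<in>set xs \<union> set C \<union> set B. m < y \<and> i < y" "m < i" "sorted (C @ B)"
  shows "word_poly (- 1) (xs @ m # C @ i # B) = var m ^ length xs *
    (var i ^ length xs * (hook_factor (var m) (var i) (length C) * word_poly (- 1) (xs @ C @ B)))"
proof -
  let ?K = "word_poly (- 1) (xs @ C @ B)" and ?F = "\<lambda>ys. word_poly (- 1) (xs @ ys)"
  have F: "?F (C1 @ i # C2 @ B) = var i ^ (length xs + length C1) * ?K" if "C1 @ C2 = C" for C1 C2
  proof -
    have "sorted (C2 @ B)" using assms(3) that by (auto simp: sorted_append)
    moreover have "\<forall>y\<in>set (xs @ C1) \<union> set (C2 @ B). i < y" using assms(1) that by auto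
    ultimately show ?thesis
      using word_poly_append_sorted[of "xs @ C1" "C2 @ B" i "- 1"] by (simp flip: that)
  qed
  have "hecke_row (- 1) (var m) 0 (length C1) ?F (C1 @ i # C2 @ B)
      = var i ^ length xs * (hook_factor (var m) (var i) (length C1) * ?K)" if "C1 @ C2 = C" for C1 C2
    using that
  proof (induction C1 arbitrary: C2 rule: rev_induct)
    case Nil
    then show ?case using F[of "[]" C2] by simp
  next
    case (snoc c C1)
    have "sorted (C1 @ [c])" using assms(3) snoc.prems by (auto simp: sorted_append)
    then have "\<not> adj_descent k (C1 @ c # i # C2 @ B)" if "k < length C1" for k
      using adj_descent_append_left[of k "C1 @ [c]" "i # C2 @ B"] sorted_no_adj_descent that by auto
    then have "hecke_row (- 1) (var m) 0 (length C1) ?F (C1 @ c # i # C2 @ B) = ?F (C1 @ c # i # C2 @ B)"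
      using hecke_row_no_descent[of 0 0 "length C1" "C1 @ c # i # C2 @ B"] by simp
    moreover have "?F (C1 @ c # i # C2 @ B) = var i ^ (length xs + Suc (length C1)) * ?K"
      using F[of "C1 @ [c]" C2] snoc.prems by simp
    moreover have "i < c" using assms(1) snoc.prems by auto
    ultimately show ?case
      using snoc.IH[of "c # C2"] snoc.prems
      by (simp add: hecke_step_def hecke_gen_def adj_descent_append swap_adj_append)
        (simp add: algebra_simps power_add)
  qed
  from this[of C "[]"]
  have "hecke_row (- 1) (var m) 0 (length C) ?F (C @ i # B)
      = var i ^ length xs * (hook_factor (var m) (var i) (length C) * ?K)" by simp
  moreover have "hecke_row (- 1) (var m) 0 (length (C @ i # B) - 1) ?F (C @ i # B)
      = hecke_row (- 1) (var m) 0 (length C) ?F (C @ i # B)"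
  proof (rule hecke_row_no_descent)
    have iB: "sorted (i # B)" using assms by (auto simp: sorted_append less_imp_le)
    fix k assume "0 + length C \<le> k"
    then show "\<not> adj_descent k (C @ i # B)"
      using adj_descent_append_right[of C k "i # B"] sorted_no_adj_descent[OF iB] by auto
  qed simp
  ultimately show ?thesis
    using word_poly_append[of xs "C @ i # B" m "- 1"] assms by auto
qed

text \<open>The word with i l has to be carried along. If P and Q are the polynomials of the words
  with l i and with i l, inserting a new smallest letter m into the block turns them, up to a power
  of x_m, into P + x_m (Q - P) and Q. If P = (1 - R) Q, the former is (1 - (1 - x_m) R) Q, so R
  gains one factor. Multiplicity-freeness ensures that l i is the only descent behind m. The factor
  M built up here is a monomial, of which only the variables and the effect on saturation are
  recorded.\<close>

lemma word_poly_block: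
  assumes "distinct (X @ Z @ l # i # B)" "multiplicity_free (X @ Z @ l # i # B)"
    and "\<forall>y\<in>set X. i < y" "\<forall>y\<in>set Z. y < i" "i < l" "sorted (l # B)"
  shows "multiplicity_free (X @ l # B) \<and> (\<exists>M. vars_in (insert i (set Z)) M \<and> (\<forall>f. saturated f \<longrightarrow> saturated (M * f))
    \<and> word_poly (- 1) (X @ Z @ i # l # B) = M * word_poly (- 1) (X @ l # B)
    \<and> word_poly (- 1) (X @ Z @ l # i # B)
        = (1 - (\<Prod>q\<in>insert i (set Z). 1 - var q)) * (M * word_poly (- 1) (X @ l # B)))"
  using assms
proof (induction "length Z" arbitrary: Z)
  case 0
  have B: "\<forall>y\<in>set B. l \<le> y" "sorted B" using 0 by auto
  then have m: "\<forall>y\<in>set X \<union> set (l # B). i < y" "\<forall>y\<in>set (X @ [l]) \<union> set B. i < y"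
    using 0 by auto
  have "multiplicity_free ((X @ [l]) @ B)"
    using multiplicity_free_remove_min[of "X @ [l]" i B] 0 m by simp
  moreover have "word_poly (- 1) (X @ i # l # B) = var i ^ length X * word_poly (- 1) (X @ l # B)"
    using word_poly_append_sorted[OF m(1)] 0 by simp
  moreover have "word_poly (- 1) (X @ l # i # B) = var i * (var i ^ length X * word_poly (- 1) (X @ l # B))"
    using word_poly_append_sorted[OF m(2), of "- 1"] B by simp
  ultimately show ?case
    using 0 by (auto intro!: exI[of _ "var i ^ length X"] vars_in_power saturated_var_power_mult)
next
  case (Suc n)
  then have "Z \<noteq> []" "distinct Z" by auto
  then obtain Z1 m Z2 where Z: "Z = Z1 @ m # Z2" and mZ: "\<forall>y\<in>set Z1 \<union> set Z2. m < y"
    using split_min by metis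
  let ?xs = "X @ Z1" and ?ys = "Z2 @ l # i # B"
  have mi: "m < i" using Suc.prems Z by auto
  have B: "\<forall>y\<in>set B. l \<le> y" "sorted B" using Suc.prems by auto
  have m: "\<forall>y\<in>set ?xs \<union> set ?ys. m < y" using mi mZ Suc.prems B(1) by fastforce
  have z: "X @ Z @ l # i # B = ?xs @ m # ?ys" "X @ Z @ i # l # B = ?xs @ m # Z2 @ i # l # B"
    by (simp_all add: Z)
  have mf: "multiplicity_free (?xs @ m # ?ys)" and d: "distinct (?xs @ m # ?ys)"
    using Suc.prems(1,2) unfolding z by auto
  have k: "adj_descent (length Z2) ?ys" using Suc.prems by (simp add: adj_descent_append)
  have "\<not> adj_descent k (Z2 @ [l])" for k
    using multiplicity_free_unique_descent[OF mf m d k, of k] adj_descent_append_left[of k "Z2 @ [l]" "i # B"]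
    by (auto simp: adj_descent_def)
  then have Zl: "sorted (Z2 @ [l])" by (rule no_adj_descent_sorted)
  then have Zi: "sorted (Z2 @ [i])" using Suc.prems(4) by (auto simp: sorted_append Z less_imp_le)
  have iB: "sorted (i # B)" using B Suc.prems(5) by auto
  have ZilB: "sorted (Z2 @ i # l # B)"
    using Zi B Suc.prems(5) by (fastforce simp: sorted_append)
  let ?D = "word_poly (- 1) (X @ l # B)" and ?S = "insert i (set (Z1 @ Z2))"
  have "multiplicity_free (X @ l # B) \<and> (\<exists>M. vars_in ?S M \<and> (\<forall>f. saturated f \<longrightarrow> saturated (M * f))
    \<and> word_poly (- 1) (X @ (Z1 @ Z2) @ i # l # B) = M * ?D
    \<and> word_poly (- 1) (X @ (Z1 @ Z2) @ l # i # B) = (1 - (\<Prod>q\<in>?S. 1 - var q)) * (M * ?D))"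
  proof (rule Suc.hyps(1))
    show "multiplicity_free (X @ (Z1 @ Z2) @ l # i # B)"
      using multiplicity_free_remove_min[OF mf m] by simp
  qed (use Suc.prems Suc.hyps(2) in \<open>auto simp: Z\<close>)
  then obtain M where M: "multiplicity_free (X @ l # B)" "vars_in ?S M" "\<And>f. saturated f \<Longrightarrow> saturated (M * f)"
    "word_poly (- 1) (?xs @ Z2 @ i # l # B) = M * ?D"
    "word_poly (- 1) (?xs @ ?ys) = (1 - (\<Prod>q\<in>?S. 1 - var q)) * (M * ?D)"
    by auto
  have S: "insert i (set Z) = insert m ?S" "m \<notin> ?S" using Suc.prems(1) mi by (auto simp: Z)
  let ?M = "var m ^ length ?xs * M"
  have "word_poly (- 1) (X @ Z @ i # l # B) = ?M * ?D"
    unfolding z(2) using word_poly_append_sorted[of ?xs "Z2 @ i # l # B" m "- 1"] m ZilB M(4)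
    by (auto simp: mult.assoc)
  moreover have "word_poly (- 1) (X @ Z @ l # i # B) = (1 - (\<Prod>q\<in>insert i (set Z). 1 - var q)) * (?M * ?D)"
  proof -
    have "word_poly (- 1) (X @ Z @ l # i # B) = var m ^ length ?xs *
        (word_poly (- 1) (?xs @ ?ys) + var m * (word_poly (- 1) (?xs @ Z2 @ i # l # B) + - 1 * word_poly (- 1) (?xs @ ?ys)))"
      unfolding z(1) word_poly_append[OF m] hecke_row_one_descent[OF Zl Zi iB Suc.prems(5)] ..
    moreover have "(\<Prod>q\<in>insert i (set Z). 1 - var q) = (1 - var m) * (\<Prod>q\<in>?S. 1 - var q)"
      unfolding S(1) using S(2) by (intro prod.insert) auto
    ultimately show ?thesis unfolding M(4,5) by (simp only:) (simp add: algebra_simps)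
  qed
  moreover have "vars_in (insert i (set Z)) ?M"
    unfolding S(1) using M(2) by (intro vars_in_mult vars_in_power) (auto intro: vars_in_mono)
  moreover have "saturated (?M * f)" if "saturated f" for f
    using M(3)[OF that] saturated_var_power_mult by (simp add: mult.assoc)
  ultimately show ?case using M(1) by blast
qed

text \<open>With a descent behind m, two shapes are possible. Either all letters other than m and i
  exceed i, which gives \<open>hook_factor\<close>; or the letters below i form a block immediately
  before l, which gives the factor over this block and i. In both cases the remaining word avoids
  the variables of the factor.\<close>

lemma saturated_word_poly:
  "distinct z \<Longrightarrow> multiplicity_free z \<Longrightarrow> saturated (word_poly (- 1) z)"
proof (induction "length z" arbitrary: z rule: less_induct)
  case less
  note vars = vars_in_word_poly[of "- 1", simplified]
  show ?case
  proof (cases "z = []")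
    case True
    then show ?thesis by (simp add: saturated_1)
  next
    case False
    then obtain xs m ys where z: "z = xs @ m # ys" and m: "\<forall>y\<in>set xs \<union> set ys. m < y"
      using split_min[OF less.prems(1)] by metis
    have d: "distinct (xs @ m # ys)" and mf: "multiplicity_free (xs @ m # ys)" using less.prems z by auto
    have mf': "multiplicity_free (xs @ ys)" by (rule multiplicity_free_remove_min[OF mf m])
    show ?thesis
    proof (cases "sorted ys")
      case True
      have "saturated (word_poly (- 1) (xs @ ys))"
        using less.hyps[of "xs @ ys"] mf' d by (simp add: z)
      then show ?thesis
        unfolding z word_poly_append_sorted[OF m True] by (rule saturated_var_power_mult)
    next
      case False
      then obtain A l i B where ys: "ys = A @ l # i # B" and il: "i < l" and Al: "sorted (A @ [l])"
        and lB: "sorted (l # B)" and before_i: "\<And>p q r. xs @ A = p @ q # r \<Longrightarrow> q < i \<Longrightarrow> \<forall>y\<in>set r. y < i"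
        using multiplicity_free_structure[OF mf m d] by metis
      have mi: "m < i" using m by (simp add: ys)
      show ?thesis
      proof (cases "\<forall>y\<in>set xs \<union> set A. i < y")
        case True
        \<comment> \<open>The letter i can pass l as well as A; in particular the index of the hook
          factor is positive.\<close>
        let ?C = "A @ [l]"
        have gt: "\<forall>y\<in>set xs \<union> set ?C \<union> set B. m < y \<and> i < y"
          using True m il lB by (fastforce simp: ys)
        have "sorted (?C @ B)" using Al lB by (auto simp: sorted_append intro: order_trans)
        note eq = word_poly_second_min[OF gt mi this]
        have "multiplicity_free ((xs @ ?C) @ B)"
          using multiplicity_free_remove_min[of "xs @ ?C" i B] mf' gt by (simp add: ys)
        then have "saturated (word_poly (- 1) (xs @ ?C @ B))"
          using less.hyps[of "xs @ ?C @ B"] d by (simp add: z ys)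
        moreover have "{m, i} \<inter> set (xs @ ?C @ B) = {}" using gt by auto
        ultimately have "saturated (hook_factor (var m) (var i) (length ?C) * word_poly (- 1) (xs @ ?C @ B))"
          using mi by (intro saturated_mult_disjoint[OF vars_in_hook_factor vars] saturated_hook_factor) auto
        then have "saturated (word_poly (- 1) (xs @ m # ?C @ i # B))"
          unfolding eq by (intro saturated_var_power_mult)
        then show ?thesis by (simp add: z ys)
      next
        case False
        have "i \<notin> set xs \<union> set A" using d by (auto simp: ys)
        \<comment> \<open>Z starts at the first letter below i in \<open>xs @ m # A\<close>. That no
          letter above i follows comes from \<open>before_i\<close> and, for a part of A, from its
          sortedness.\<close>
        obtain X Z where XZ: "xs @ m # A = X @ Z" "\<forall>y\<in>set X. i < y" "\<forall>y\<in>set Z. y < i"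
        proof (cases "\<exists>y\<in>set xs. y < i")
          case True
          then obtain X f Z1 where xs: "xs = X @ f # Z1" "f < i" "\<forall>y\<in>set X. \<not> y < i"
            using split_list_first_prop[of xs "\<lambda>y. y < i"] by metis
          have "\<forall>y\<in>set (Z1 @ A). y < i" using before_i[of X f "Z1 @ A"] xs by simp
          moreover have "\<forall>y\<in>set X. i < y" using xs(3) \<open>i \<notin> set xs \<union> set A\<close> by (auto simp: xs(1) not_less order_le_less)
          ultimately show ?thesis using that[of X "f # Z1 @ m # A"] xs mi by auto
        next
          case no: False
          then obtain q where q: "q \<in> set A" "q < i"
            using False \<open>i \<notin> set xs \<union> set A\<close> by (metis Un_iff linorder_neqE_nat)
          then obtain A1 A2 where A: "A = A1 @ q # A2" by (meson split_list)
          have "\<forall>y\<in>set A2. y < i" using before_i[of "xs @ A1" q A2] q by (simp add: A)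
          moreover have "\<forall>y\<in>set A1. y < i" using Al q(2) by (auto simp: A sorted_append)
          moreover have "\<forall>y\<in>set xs. i < y"
            using no \<open>i \<notin> set xs \<union> set A\<close> by (metis UnCI linorder_neqE_nat)
          ultimately show ?thesis using that[of xs "m # A"] mi q by (auto simp: A)
        qed
        have z': "z = X @ Z @ l # i # B"
          using arg_cong[OF XZ(1), of "\<lambda>u. u @ l # i # B"] by (simp add: z ys)
        have "multiplicity_free (X @ l # B) \<and> (\<exists>M. vars_in (insert i (set Z)) M \<and> (\<forall>f. saturated f \<longrightarrow> saturated (M * f))
          \<and> word_poly (- 1) (X @ Z @ i # l # B) = M * word_poly (- 1) (X @ l # B)
          \<and> word_poly (- 1) (X @ Z @ l # i # B)
              = (1 - (\<Prod>q\<in>insert i (set Z). 1 - var q)) * (M * word_poly (- 1) (X @ l # B)))"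
          using less.prems XZ il lB unfolding z' by (intro word_poly_block)
        then obtain M where M: "multiplicity_free (X @ l # B)" "vars_in (insert i (set Z)) M"
          "\<And>f. saturated f \<Longrightarrow> saturated (M * f)"
          "word_poly (- 1) z = (1 - (\<Prod>q\<in>insert i (set Z). 1 - var q)) * (M * word_poly (- 1) (X @ l # B))"
          unfolding z' by blast
        let ?P = "1 - (\<Prod>q\<in>insert i (set Z). 1 - var q)"
        have "distinct (X @ l # B)" using less.prems(1) by (auto simp: z')
        then have "saturated (word_poly (- 1) (X @ l # B))"
          using less.hyps[of "X @ l # B"] M(1) by (simp add: z')
        moreover have "saturated (M * ?P)"
          by (intro M(3) saturated_one_minus_prod) auto
        moreover have "vars_in (insert i (set Z)) (M * ?P)"
        proof -
          have "vars_in V (\<Prod>q\<in>T. 1 - var q)" if "finite T" "T \<subseteq> V" for T V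
            using that by (induction T) (auto intro!: vars_in_mult vars_in_diff)
          then show ?thesis using M(2) by (auto intro!: vars_in_mult vars_in_diff)
        qed
        moreover have "insert i (set Z) \<inter> set (X @ l # B) = {}"
          using less.prems(1) by (auto simp: z')
        ultimately have "saturated ((M * ?P) * word_poly (- 1) (X @ l # B))"
          using saturated_mult_disjoint vars by blast
        then show ?thesis by (simp add: M(4) mult_ac)
      qed
    qed
  qed
qed

theorem theorem1p7:
  fixes n :: nat and w :: "nat \<Rightarrow> nat"
  assumes "n \<ge> 1"
    and "w permutes {1..n}"
    and "zero_one (grothendieck n w)"
  shows "(\<forall>\<alpha> \<in> supp (grothendieck n w). weight \<alpha> < total_degree (grothendieck n w)
            \<longrightarrow> (\<exists>\<beta> \<in> supp (grothendieck n w). \<alpha> \<prec> \<beta>))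
       \<and> (\<forall>\<alpha> \<in> supp (grothendieck n w). weight \<alpha> < total_degree (grothendieck n w)
            \<longrightarrow> (\<exists>\<beta> \<in> supp (grothendieck n w). \<alpha> \<prec> \<beta> \<and> weight \<beta> = weight \<alpha> + 1))
       \<and> (\<forall>\<beta> \<in> supp (top_component (grothendieck n w)).
            (\<Sum>\<alpha> | \<alpha> \<preceq> \<beta>. coeff (grothendieck n w) \<alpha>) = 1)"
proof -
  let ?z = "map (inv w) [1..<Suc n]" and ?G = "grothendieck n w"
  have G: "?G = word_poly (- 1) ?z" by (rule grothendieck_word_poly) fact
  have "distinct ?z"
    using permutes_inj[OF permutes_inv[OF assms(2)]] by (simp add: distinct_map inj_on_def)
  then have "saturated ?G"
    unfolding G using assms(3) by (intro saturated_word_poly zero_one_imp_multiplicity_free) (simp_all only: G)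
  then obtain d where top: "\<exists>\<alpha>\<in>supp ?G. weight \<alpha> = d"
    and up: "\<And>\<alpha>. \<alpha> \<in> supp ?G \<Longrightarrow> weight \<alpha> = d \<or> weight \<alpha> < d \<and> (\<exists>k. \<alpha> + Poly_Mapping.single k 1 \<in> supp ?G)"
    and sum: "\<And>\<beta>. \<beta> \<in> supp ?G \<Longrightarrow> weight \<beta> = d \<Longrightarrow> (\<Sum>\<alpha> | \<alpha> \<preceq> \<beta>. coeff ?G \<alpha>) = 1"
    unfolding saturated_def by metis
  have deg: "total_degree ?G = d"
    unfolding total_degree_def by (rule Max_eqI) (use top up in force)+
  \<comment> \<open>Raising a single exponent by one gives (2), which implies (1).\<close>
  have "\<exists>\<beta>\<in>supp ?G. \<alpha> \<prec> \<beta> \<and> weight \<beta> = weight \<alpha> + 1" if \<alpha>: "\<alpha> \<in> supp ?G" "weight \<alpha> < d" for \<alpha>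
  proof -
    obtain k where k: "\<alpha> + Poly_Mapping.single k 1 \<in> supp ?G" using up[OF \<alpha>(1)] \<alpha>(2) by auto
    have "weight (\<alpha> + Poly_Mapping.single k 1) = weight \<alpha> + 1" by (simp add: weight_add)
    moreover from this have "\<alpha> \<prec> \<alpha> + Poly_Mapping.single k 1"
      by (auto simp: exp_less_def exp_le_def lookup_add)
    ultimately show ?thesis using k by blast
  qed
  moreover have "(\<Sum>\<alpha> | \<alpha> \<preceq> \<beta>. coeff ?G \<alpha>) = 1" if "\<beta> \<in> supp (top_component ?G)" for \<beta>
  proof (rule sum)
    show "\<beta> \<in> supp ?G" "weight \<beta> = d"
      using that by (auto simp: top_component_def deg in_keys_iff coeff_homogeneous_component split: if_splits)
  qed
  ultimately show ?thesis unfolding deg by blast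
qed

end
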